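(* Under Assumptions 1–3, assume $r_\ell<\min\{m_\ell,n_\ell\}$ for all $\ell$. If $0<\beta_1\le1$, $\tau\ge\frac{64}{3\beta_1\underline\delta}$, and $0<\eta\le\min\Big\{\frac1{4L},\sqrt{\frac{3\underline\delta\beta_1^2}{80L^2}},\sqrt{\frac{3\underline\delta}{80\tau^2L^2}},\sqrt{\frac{3\beta_1}{16\tau L^2}}\Big\}$, then GoLore using small-batch stochastic gradients and MSGD with momentum projection satisfies, for every integer $K\ge1$, $\frac1{K\tau}\sum_{t=0}^{K\tau-1}\mathbb{E}\|\nabla f(x^{(t)})\|_2^2\le\frac{16\Delta}{\underline\delta\eta K\tau}+\frac{32\beta_1\sigma^2}{3\underline\delta}.$
   Context: Parameters $x=(\mathrm{vec}(X_1)^\top,\dots,\mathrm{vec}(X_{N_L})^\top)^\top\in\mathbb{R}^d$, $X_\ell\in\mathbb{R}^{m_\ell\times n_\ell}$; $f(x)=\mathbb{E}_{\xi\sim\mathcal D}F(x;\xi)$; $\nabla_\ell$ is the gradient w.r.t. $X_\ell$. Assumption 1: $\inf f>-\infty$. Assumption 2: $\nabla f$ is $L$-Lipschitz in $\|\cdot\|_2$. Assumption 3: $\mathbb{E}_\xi[\nabla_\ell F(x;\xi)]=\nabla_\ell f(x)$ and $\mathbb{E}_\xi\|\nabla_\ell F(x;\xi)-\nabla_\ell f(x)\|_F^2\le\sigma_\ell^2$ for all $x,\ell$; $\sigma^2=\sum_\ell\sigma_\ell^2$. $\Delta=f(x^{(0)})-\inf f$, $\delta_\ell=r_\ell/\min\{m_\ell,n_\ell\}$,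 $\underline\delta=\min_\ell\delta_\ell$. $\mathcal U(\mathrm{St}_{m,r})$ is the uniform (Haar) distribution on $\mathrm{St}_{m,r}=\{P\in\mathbb{R}^{m\times r}:P^\top P=I_r\}$. Algorithm: $M_\ell^{(-1)}=0$. For $t\ge0$ draw $\xi^{(t)}\sim\mathcal D$ independently, $G_\ell^{(t)}=\nabla_\ell F(x^{(t)};\xi^{(t)})$. If $t\equiv0\pmod\tau$ sample $P_\ell^{(t)}\sim\mathcal U(\mathrm{St}_{m_\ell,r_\ell})$, $Q_\ell^{(t)}\sim\mathcal U(\mathrm{St}_{n_\ell,r_\ell})$ independently of everything else; otherwise $P_\ell^{(t)}=P_\ell^{(t-1)}$, $Q_\ell^{(t)}=Q_\ell^{(t-1)}$. If $m_\ell\le n_\ell$: $M_\ell^{(t)}=(1-\beta_1)(P_\ell^{(t)})^\top P_\ell^{(t-1)}M_\ell^{(t-1)}+\beta_1(P_\ell^{(t)})^\top G_\ell^{(t)}$, $X_\ell^{(t+1)}=X_\ell^{(t)}-\eta P_\ell^{(t)}M_\ell^{(t)}$. If $m_\ell>n_\ell$: $M_\ell^{(t)}=(1-\beta_1)M_\ell^{(t-1)}(Q_\ell^{(t-1)})^\top Q_\ell^{(t)}+\beta_1G_\ell^{(t)}Q_\ell^{(t)}$, $X_\ell^{(t+1)}=X_\ell^{(t)}-\eta M_\ell^{(t)}(Q_\ell^{(t)})^\top$. *)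

theory Defs
  imports "HOL-Probability.Probability"
begin

text \<open>Matrices of varying size are represented as functions nat => nat => real;
  only the entries inside the stated dimensions are meaningful.\<close>

type_synonym mat = "nat \<Rightarrow> nat \<Rightarrow> real"

definition mmul :: "nat \<Rightarrow> mat \<Rightarrow> mat \<Rightarrow> mat" where
  "mmul p A B = (\<lambda>i j. \<Sum>k<p. A i k * B k j)"

definition mtr :: "mat \<Rightarrow> mat" where
  "mtr A = (\<lambda>i j. A j i)"

definition mlin :: "real \<Rightarrow> mat \<Rightarrow> real \<Rightarrow> mat \<Rightarrow> mat" where
  "mlin a A b B = (\<lambda>i j. a * A i j + b * B i j)"

definition mzero :: mat where
  "mzero = (\<lambda>i j. 0)"

definition frob_sq :: "nat \<Rightarrow> nat \<Rightarrow> mat \<Rightarrow> real" where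
  "frob_sq m n A = (\<Sum>i<m. \<Sum>j<n. (A i j)\<^sup>2)"

definition stiefel :: "nat \<Rightarrow> nat \<Rightarrow> mat set" where
  "stiefel m r = {P. (\<forall>i j. (m \<le> i \<or> r \<le> j) \<longrightarrow> P i j = 0) \<and>
      (\<forall>i<r. \<forall>j<r. (\<Sum>k<m. P k i * P k j) = (if i = j then 1 else 0))}"

definition mat_M :: "mat measure" where
  "mat_M = Pi\<^sub>M UNIV (\<lambda>_. Pi\<^sub>M UNIV (\<lambda>_. borel))"

definition haar_stiefel :: "nat \<Rightarrow> nat \<Rightarrow> mat measure \<Rightarrow> bool" where
  "haar_stiefel m r \<mu> \<longleftrightarrow> prob_space \<mu> \<and> sets \<mu> = sets mat_M \<and>
      emeasure \<mu> (stiefel m r) = 1 \<and>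
      (\<forall>U\<in>stiefel m m. distr \<mu> mat_M (\<lambda>P. mmul m U P) = \<mu>)"

text \<open>Layer structure: idx is a bijection from the coordinate type 'k of the parameter
  vector onto the triples (layer, row, column).\<close>
definition blk :: "('k \<Rightarrow> nat \<times> nat \<times> nat) \<Rightarrow> real ^ 'k \<Rightarrow> nat \<Rightarrow> mat" where
  "blk idx v l = (\<lambda>i j. if (l, i, j) \<in> range idx then v $ inv idx (l, i, j) else 0)"

definition unblk :: "('k \<Rightarrow> nat \<times> nat \<times> nat) \<Rightarrow> (nat \<Rightarrow> mat) \<Rightarrow> real ^ 'k" where
  "unblk idx Xs = (\<chi> k. case idx k of (l, i, j) \<Rightarrow> Xs l i j)"

text \<open>One GoLore step (momentum projection + MSGD). State = (x^(t), M^(t-1)).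
  Pseq/Qseq k l = projection sampled at the start of period k (times k*tau).\<close>
definition golore_step ::
  "nat \<Rightarrow> real \<Rightarrow> real \<Rightarrow> (nat \<Rightarrow> nat) \<Rightarrow> (nat \<Rightarrow> nat) \<Rightarrow> (nat \<Rightarrow> nat) \<Rightarrow>
   ('k \<Rightarrow> nat \<times> nat \<times> nat) \<Rightarrow> (real ^ 'k \<Rightarrow> 'xi \<Rightarrow> real ^ 'k) \<Rightarrow>
   (nat \<Rightarrow> 'xi) \<Rightarrow> (nat \<Rightarrow> nat \<Rightarrow> mat) \<Rightarrow> (nat \<Rightarrow> nat \<Rightarrow> mat) \<Rightarrow> nat \<Rightarrow>
   (real ^ 'k) \<times> (nat \<Rightarrow> mat) \<Rightarrow> (real ^ 'k) \<times> (nat \<Rightarrow> mat)" where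
  "golore_step \<tau> \<beta>\<^sub>1 \<eta> m n r idx gF xi Pseq Qseq t st =
     (let x = fst st; Mo = snd st;
          G = blk idx (gF x (xi t));
          P = (\<lambda>l. Pseq (t div \<tau>) l); P' = (\<lambda>l. Pseq ((t - 1) div \<tau>) l);
          Q = (\<lambda>l. Qseq (t div \<tau>) l); Q' = (\<lambda>l. Qseq ((t - 1) div \<tau>) l);
          Mn = (\<lambda>l. if m l \<le> n l then
                  mlin (1 - \<beta>\<^sub>1) (mmul (r l) (mmul (m l) (mtr (P l)) (P' l)) (Mo l))
                       \<beta>\<^sub>1 (mmul (m l) (mtr (P l)) (G l))
                else
                  mlin (1 - \<beta>\<^sub>1) (mmul (n l) (mmul (r l) (Mo l) (mtr (Q' l))) (Q l))
                       \<beta>\<^sub>1 (mmul (n l) (G l) (Q l)));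
          D = unblk idx (\<lambda>l. if m l \<le> n l then mmul (r l) (P l) (Mn l)
                             else mmul (r l) (Mn l) (mtr (Q l)))
      in (x - \<eta> *\<^sub>R D, Mn))"

primrec golore_state ::
  "nat \<Rightarrow> real \<Rightarrow> real \<Rightarrow> (nat \<Rightarrow> nat) \<Rightarrow> (nat \<Rightarrow> nat) \<Rightarrow> (nat \<Rightarrow> nat) \<Rightarrow>
   ('k \<Rightarrow> nat \<times> nat \<times> nat) \<Rightarrow> (real ^ 'k \<Rightarrow> 'xi \<Rightarrow> real ^ 'k) \<Rightarrow> real ^ 'k \<Rightarrow>
   (nat \<Rightarrow> 'xi) \<Rightarrow> (nat \<Rightarrow> nat \<Rightarrow> mat) \<Rightarrow> (nat \<Rightarrow> nat \<Rightarrow> mat) \<Rightarrow> nat \<Rightarrow>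
   (real ^ 'k) \<times> (nat \<Rightarrow> mat)" where
  "golore_state \<tau> \<beta>\<^sub>1 \<eta> m n r idx gF x0 xi Pseq Qseq 0 = (x0, (\<lambda>l. mzero))"
| "golore_state \<tau> \<beta>\<^sub>1 \<eta> m n r idx gF x0 xi Pseq Qseq (Suc t) =
     golore_step \<tau> \<beta>\<^sub>1 \<eta> m n r idx gF xi Pseq Qseq t
       (golore_state \<tau> \<beta>\<^sub>1 \<eta> m n r idx gF x0 xi Pseq Qseq t)"

definition golore_x where
  "golore_x \<tau> \<beta>\<^sub>1 \<eta> m n r idx gF x0 xi Pseq Qseq t =
     fst (golore_state \<tau> \<beta>\<^sub>1 \<eta> m n r idx gF x0 xi Pseq Qseq t)"

definition rv_sets :: "'a measure \<Rightarrow> 'b measure \<Rightarrow> ('a \<Rightarrow> 'b) \<Rightarrow> 'a set set" where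
  "rv_sets M N X = {X -` A \<inter> space M | A. A \<in> sets N}"

definition delta_min :: "nat \<Rightarrow> (nat \<Rightarrow> nat) \<Rightarrow> (nat \<Rightarrow> nat) \<Rightarrow> (nat \<Rightarrow> nat) \<Rightarrow> real" where
  "delta_min NL m n r = Min ((\<lambda>l. real (r l) / real (min (m l) (n l))) ` {..<NL})"

end

theory Submission
  imports Defs
begin

text \<open>In terms of the full-space momentum \<open>p\<^sub>t\<close> (\<open>P\<^sub>t M\<^sub>t\<close> or \<open>M\<^sub>t Q\<^sub>t\<^sup>T\<close> in each layer) one step reads
  \<open>p\<^sub>t = \<Pi> ((1 - \<beta>) p\<^sub>t\<^sub>-\<^sub>1 + \<beta> G\<^sub>t)\<close>, \<open>x\<^sub>t\<^sub>+\<^sub>1 = x\<^sub>t - \<eta> p\<^sub>t\<close>, where \<open>\<Pi>\<close> is the orthogonal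
  projection of the current period. Hence the momentum error splits orthogonally into an inner part
  \<open>p\<^sub>t - \<Pi> g\<^sub>t\<close> and an outer part \<open>g\<^sub>t - \<Pi> g\<^sub>t\<close>. The inner part contracts by the factor
  \<open>1 - \<beta>\<close>, except that resampling \<open>\<Pi>\<close> adds at most \<open>\<parallel>g\<^sub>t\<parallel>\<^sup>2\<close>; over a period this is
  harmless because \<open>\<tau>\<close> is of order \<open>1 / (\<beta> \<delta>)\<close>. The outer part loses a fraction \<open>\<delta>\<close> of
  \<open>\<parallel>g\<parallel>\<^sup>2\<close> in expectation, because the Haar projection is independent of the iterate and
  has mean \<open>r / m\<close> times the identity, and then only drifts with the step sizes. The descent lemma
  pays for all drift terms.\<close>

section \<open>Joint measurability, smoothness and independence\<close>

text \<open>The stored momenta live in coordinates that change at each resampling. Lifted back to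
  the parameter space, the left and right projections of all layers become one block-diagonal
  orthogonal projection, so the rate is proved without layers, in the locale
  \<open>subspace_momentum\<close>.

  The obstacle is dependence: within a period the projection is correlated with the later iterates,
  so its mean may be used only at the gradient of the period start. Young's inequality with weight
  \<open>\<delta> / 4\<close> is applied on the way to that gradient and again on the way back; of
  the gain \<open>\<delta>\<close> a share \<open>\<delta> / 2\<close> survives. Resampling charges
  one squared gradient per period, amplified by \<open>1 / \<beta>\<close> when the contraction is
  summed; the lower bound on \<open>\<tau>\<close> makes this cost only
  \<open>3 * \<delta> / 32\<close>. What remains, \<open>13 * \<delta> / 32\<close>, yields the
  rate.

  No conditional expectations occur: each average over fresh randomness is an iterated nonnegative
  integral over a product law. This requires \<open>gF\<close> to be jointly measurable, which is
  derived from differentiability of \<open>F\<close>.\<close>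

lemma caratheodory_borel_measurable:
  fixes F :: "'a::{second_countable_topology, metric_space} \<Rightarrow> 'b \<Rightarrow> real"
  assumes cont: "\<And>y. y \<in> space D \<Longrightarrow> continuous_on UNIV (\<lambda>x. F x y)"
    and meas: "\<And>x. F x \<in> borel_measurable D"
  shows "(\<lambda>(x, y). F x y) \<in> borel_measurable (borel \<Otimes>\<^sub>M D)"
proof -
  \<comment> \<open>Simple functions \<open>s i\<close> converging pointwise to the identity
    discretise the first argument: \<open>F (s i x) y\<close> is measurable because
    \<open>s i\<close> has finite range, and continuity of \<open>F\<close> in that argument gives
    the limit. The base point \<open>undefined\<close> is arbitrary.\<close>
  obtain s where s: "\<And>i. simple_function borel (s i)"
    and lim: "\<And>x::'a. (\<lambda>i. s i x) \<longlonglongrightarrow> x"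
    using borel_measurable_implies_sequence_metric[of "\<lambda>x::'a. x" borel undefined] by auto
  have "(\<lambda>p. F (fst p) (snd p)) \<in> borel_measurable (borel \<Otimes>\<^sub>M D)"
  proof (rule borel_measurable_LIMSEQ_real)
    fix i
    have "(\<lambda>p. (\<lambda>x p. F x (snd p)) (s i (fst p)) p) \<in> borel_measurable (borel \<Otimes>\<^sub>M D)"
    proof (rule measurable_compose_countable'[where I = "range (s i)"])
      show "(\<lambda>p. F x (snd p)) \<in> borel_measurable (borel \<Otimes>\<^sub>M D)" for x
        using meas[of x] by measurable
      have "s i \<in> measurable borel (count_space (range (s i)))"
        using simple_functionD[OF s[of i]] by (auto simp: measurable_count_space_eq2)
      then show "(\<lambda>p. s i (fst p)) \<in> measurable (borel \<Otimes>\<^sub>M D) (count_space (range (s i)))"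
        by measurable
      show "countable (range (s i))"
        using simple_functionD(1)[OF s[of i]] by (simp add: countable_finite)
    qed
    then show "(\<lambda>p. F (s i (fst p)) (snd p)) \<in> borel_measurable (borel \<Otimes>\<^sub>M D)" by simp
  next
    fix p :: "'a \<times> 'b" assume "p \<in> space (borel \<Otimes>\<^sub>M D)"
    then have "isCont (\<lambda>x. F x (snd p)) (fst p)"
      using cont[of "snd p"] by (auto simp: space_pair_measure continuous_on_eq_continuous_at)
    then show "(\<lambda>i. F (s i (fst p)) (snd p)) \<longlonglongrightarrow> F (fst p) (snd p)"
      by (rule isCont_tendsto_compose) (rule lim)
  qed
  then show ?thesis by (simp add: case_prod_beta)
qed

text \<open>Needed so that the oracle evaluated at a random iterate is a random variable. Each
  coordinate of the gradient is a limit of difference quotients of \<open>F\<close>, and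
  \<open>F\<close> is jointly measurable because it is continuous in the point and measurable in the
  sample.\<close>

lemma gradient_borel_measurable:
  fixes F :: "'a::euclidean_space \<Rightarrow> 'b \<Rightarrow> real"
  assumes deriv: "\<And>x y. ((\<lambda>x. F x y) has_derivative (\<lambda>h. gF x y \<bullet> h)) (at x)"
    and meas: "\<And>x. F x \<in> borel_measurable D"
  shows "(\<lambda>(x, y). gF x y) \<in> borel_measurable (borel \<Otimes>\<^sub>M D)"
proof -
  have cont: "continuous_on UNIV (\<lambda>x. F x y)" for y
    using has_derivative_continuous[OF deriv[of y]] by (simp add: continuous_on_eq_continuous_at)
  have F: "(\<lambda>p. F (fst p) (snd p)) \<in> borel_measurable (borel \<Otimes>\<^sub>M D)"
    using caratheodory_borel_measurable[OF cont meas] by (simp add: case_prod_beta)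
  have "(\<lambda>p. gF (fst p) (snd p) \<bullet> b) \<in> borel_measurable (borel \<Otimes>\<^sub>M D)" for b
  proof (rule borel_measurable_LIMSEQ_real)
    fix i :: nat
    have "(\<lambda>p. (fst p + (1 / real (Suc i)) *\<^sub>R b, snd p)) \<in> measurable (borel \<Otimes>\<^sub>M D) (borel \<Otimes>\<^sub>M D)"
      by measurable
    from measurable_compose[OF this F]
    have "(\<lambda>p. F (fst p + (1 / real (Suc i)) *\<^sub>R b) (snd p)) \<in> borel_measurable (borel \<Otimes>\<^sub>M D)"
      by simp
    then show "(\<lambda>p. (F (fst p + (1 / real (Suc i)) *\<^sub>R b) (snd p) - F (fst p) (snd p)) * real (Suc i))
        \<in> borel_measurable (borel \<Otimes>\<^sub>M D)"
      using F by measurable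
  next
    fix p :: "'a \<times> 'b"
    have "((\<lambda>t. F (fst p + t *\<^sub>R b) (snd p)) has_derivative (\<lambda>t. gF (fst p) (snd p) \<bullet> (t *\<^sub>R b))) (at 0)"
      by (rule has_derivative_compose[where f = "\<lambda>t::real. fst p + t *\<^sub>R b", OF _ deriv[where x = "fst p + 0 *\<^sub>R b"], simplified])
        (auto intro!: derivative_eq_intros)
    then have "((\<lambda>t. F (fst p + t *\<^sub>R b) (snd p)) has_real_derivative (gF (fst p) (snd p) \<bullet> b)) (at 0)"
      by (simp add: has_field_derivative_def mult_commute_abs)
    then have *: "((\<lambda>h. (F (fst p + h *\<^sub>R b) (snd p) - F (fst p) (snd p)) / h)
        \<longlongrightarrow> gF (fst p) (snd p) \<bullet> b) (at 0)"
      by (simp add: DERIV_def)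
    have "filterlim (\<lambda>i. 1 / real (Suc i)) (at 0) sequentially"
      using LIMSEQ_inverse_real_of_nat by (auto simp: filterlim_at field_simps)
    from filterlim_compose[OF * this]
    show "(\<lambda>i. (F (fst p + (1 / real (Suc i)) *\<^sub>R b) (snd p) - F (fst p) (snd p)) * real (Suc i))
        \<longlonglongrightarrow> gF (fst p) (snd p) \<bullet> b" by simp
  qed
  then show ?thesis
    by (subst borel_measurable_euclidean_space) (simp add: case_prod_beta)
qed

text \<open>The descent lemma without integrating along the segment: \<open>\<phi>\<close> is, up to
  a constant, the difference between \<open>f\<close> and its quadratic model, and the Lipschitz
  bound makes its derivative nonpositive on the unit interval.\<close>

lemma lipschitz_gradient_upper_bound:
  fixes f :: "'a::euclidean_space \<Rightarrow> real"
  assumes deriv: "\<And>x. (f has_derivative (\<lambda>h. g x \<bullet> h)) (at x)"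
    and lip: "\<And>x y. norm (g x - g y) \<le> L * norm (x - y)"
  shows "f (x + h) \<le> f x + g x \<bullet> h + L / 2 * (norm h)\<^sup>2"
proof -
  define \<phi> where "\<phi> t = f (x + t *\<^sub>R h) - t * (g x \<bullet> h) - L / 2 * t\<^sup>2 * (norm h)\<^sup>2" for t
  have d: "(\<phi> has_real_derivative ((g (x + t *\<^sub>R h) - g x) \<bullet> h - L * t * (norm h)\<^sup>2)) (at t)" for t
  proof -
    have "((\<lambda>t. f (x + t *\<^sub>R h)) has_derivative (\<lambda>s. g (x + t *\<^sub>R h) \<bullet> (s *\<^sub>R h))) (at t)"
      by (rule has_derivative_compose[where f = "\<lambda>t::real. x + t *\<^sub>R h", OF _ deriv])
        (auto intro!: derivative_eq_intros)
    then have "((\<lambda>t. f (x + t *\<^sub>R h)) has_real_derivative (g (x + t *\<^sub>R h) \<bullet> h)) (at t)"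
      by (simp add: has_field_derivative_def mult_commute_abs)
    then show ?thesis unfolding \<phi>_def
      by (auto intro!: derivative_eq_intros simp: inner_diff_left)
  qed
  have "\<phi> 1 \<le> \<phi> 0"
  proof (rule DERIV_nonpos_imp_nonincreasing[of 0 1 \<phi>])
    fix t :: real assume t: "0 \<le> t" "t \<le> 1"
    have "(g (x + t *\<^sub>R h) - g x) \<bullet> h \<le> norm (g (x + t *\<^sub>R h) - g x) * norm h"
      by (rule norm_cauchy_schwarz)
    also have "\<dots> \<le> (L * norm (t *\<^sub>R h)) * norm h"
      using lip[of "x + t *\<^sub>R h" x] by (intro mult_right_mono) auto
    finally have "(g (x + t *\<^sub>R h) - g x) \<bullet> h - L * t * (norm h)\<^sup>2 \<le> 0"
      using t by (simp add: power2_eq_square algebra_simps)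
    then show "\<exists>y. (\<phi> has_real_derivative y) (at t) \<and> y \<le> 0" using d by blast
  qed auto
  then show ?thesis by (simp add: \<phi>_def)
qed

text \<open>The library's \<open>indep_var\<close> forces both random variables to have the same type.\<close>

definition (in prob_space) independent_rvs ::
  "'b measure \<Rightarrow> ('a \<Rightarrow> 'b) \<Rightarrow> 'c measure \<Rightarrow> ('a \<Rightarrow> 'c) \<Rightarrow> bool" where
  "independent_rvs S X T Y \<longleftrightarrow> random_variable S X \<and> random_variable T Y \<and>
    distr M (S \<Otimes>\<^sub>M T) (\<lambda>\<omega>. (X \<omega>, Y \<omega>)) = distr M S X \<Otimes>\<^sub>M distr M T Y"

text \<open>Disjoint groups of independent intersection-stable families generate independent
  sigma-algebras. \<open>indep_var\<close> is applied to the identity map of the sample space, read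
  as a map into each of the two sigma-algebras, so that both variables have the same type; pushing
  the resulting product law forward along \<open>X\<close> and \<open>Y\<close> then allows
  different target types.\<close>

lemma (in prob_space) independent_rvs_of_indep_sets:
  assumes indep: "indep_sets E I"
    and stable: "\<And>i. i \<in> I \<Longrightarrow> Int_stable (E i)"
    and J: "J\<^sub>1 \<subseteq> I" "J\<^sub>2 \<subseteq> I" "J\<^sub>1 \<inter> J\<^sub>2 = {}"
    and X: "X \<in> measurable (sigma (space M) (\<Union>i\<in>J\<^sub>1. E i)) S"
    and Y: "Y \<in> measurable (sigma (space M) (\<Union>i\<in>J\<^sub>2. E i)) T"
  shows "independent_rvs S X T Y"
proof -
  let ?N = "\<lambda>J. sigma (space M) (\<Union>i\<in>J. E i)"
  have E: "E i \<subseteq> events" if "i \<in> I" for i using indep that unfolding indep_sets_def by auto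
  have sub: "(\<Union>i\<in>J. E i) \<subseteq> Pow (space M)" if "J \<subseteq> I" for J
    using E that sets.space_closed by blast
  have gen: "sigma_sets (space M) (\<Union>i\<in>J. E i) \<subseteq> events" if "J \<subseteq> I" for J
    using E that by (intro sets.sigma_sets_subset) blast
  have id: "(\<lambda>\<omega>. \<omega>) \<in> measurable M (?N J)" if "J \<subseteq> I" for J
    using sub[OF that] gen[OF that] by (intro measurableI) (auto simp: space_measure_of_conv)
  have pre: "sigma_sets (space M) {(\<lambda>\<omega>. \<omega>) -` A \<inter> space M |A. A \<in> sets (?N J)}
      \<subseteq> sigma_sets (space M) (\<Union>i\<in>J. E i)" if "J \<subseteq> I" for J
    using sub[OF that] by (intro sigma_sets_mono) (auto dest: sigma_sets_into_sp simp: Int_absorb2)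
  have "indep_sets (\<lambda>b. sigma_sets (space M) (\<Union>i\<in>(case b of True \<Rightarrow> J\<^sub>1 | False \<Rightarrow> J\<^sub>2). E i)) UNIV"
  proof (rule indep_sets_collect_sigma)
    show "indep_sets E (\<Union>b\<in>UNIV. case b of True \<Rightarrow> J\<^sub>1 | False \<Rightarrow> J\<^sub>2)"
      by (rule indep_sets_mono_index[OF _ indep]) (use J in \<open>auto simp: UNIV_bool\<close>)
    show "Int_stable (E i)" if "i \<in> (case b of True \<Rightarrow> J\<^sub>1 | False \<Rightarrow> J\<^sub>2)" for i b
      using that J by (intro stable) (auto split: bool.splits)
    show "disjoint_family (case_bool J\<^sub>1 J\<^sub>2)"
      using J by (auto simp: disjoint_family_on_def split: bool.splits)
  qed
  then have "indep_sets (case_bool (sigma_sets (space M) {(\<lambda>\<omega>. \<omega>) -` A \<inter> space M |A. A \<in> sets (?N J\<^sub>1)})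
      (sigma_sets (space M) {(\<lambda>\<omega>. \<omega>) -` A \<inter> space M |A. A \<in> sets (?N J\<^sub>2)})) UNIV"
    by (rule indep_sets_mono_sets) (use pre[OF J(1)] pre[OF J(2)] in \<open>auto split: bool.splits\<close>)
  then have "indep_var (?N J\<^sub>1) (\<lambda>\<omega>. \<omega>) (?N J\<^sub>2) (\<lambda>\<omega>. \<omega>)"
    using id[OF J(1)] id[OF J(2)] by (simp add: indep_var_eq indep_set_def)
  then have prod: "distr M (?N J\<^sub>1) (\<lambda>\<omega>. \<omega>) \<Otimes>\<^sub>M distr M (?N J\<^sub>2) (\<lambda>\<omega>. \<omega>)
      = distr M (?N J\<^sub>1 \<Otimes>\<^sub>M ?N J\<^sub>2) (\<lambda>\<omega>. (\<omega>, \<omega>))"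
    by (simp add: indep_var_distribution_eq)
  have X': "random_variable S X" and Y': "random_variable T Y"
    using measurable_compose[OF id[OF J(1)] X] measurable_compose[OF id[OF J(2)] Y] by simp_all
  interpret Y: prob_space "distr M T Y" using Y' by (rule prob_space_distr)
  have dX: "distr (distr M (?N J\<^sub>1) (\<lambda>\<omega>. \<omega>)) S X = distr M S X"
    using distr_distr[OF X id[OF J(1)]] by (simp add: comp_def)
  have dY: "distr (distr M (?N J\<^sub>2) (\<lambda>\<omega>. \<omega>)) T Y = distr M T Y"
    using distr_distr[OF Y id[OF J(2)]] by (simp add: comp_def)
  have "distr M S X \<Otimes>\<^sub>M distr M T Y
      = distr (distr M (?N J\<^sub>1) (\<lambda>\<omega>. \<omega>) \<Otimes>\<^sub>M distr M (?N J\<^sub>2) (\<lambda>\<omega>. \<omega>)) (S \<Otimes>\<^sub>M T) (\<lambda>(\<omega>, \<omega>'). (X \<omega>, Y \<omega>'))"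
    unfolding dX[symmetric] dY[symmetric]
    by (rule pair_measure_distr)
      (use X Y Y.sigma_finite_measure_axioms in \<open>simp_all add: dY\<close>)
  also have "\<dots> = distr M (S \<Otimes>\<^sub>M T) (\<lambda>\<omega>. (X \<omega>, Y \<omega>))"
    unfolding prod
    using X Y id[OF J(1)] id[OF J(2)] by (subst distr_distr) (auto simp: comp_def)
  finally show ?thesis using X' Y' by (simp add: independent_rvs_def)
qed

text \<open>The substitute for conditioning: with \<open>X\<close> frozen, \<open>Y\<close> is
  averaged over its own law. For nonnegative integrands no integrability has to be known beforehand,
  so it can itself serve to prove square integrability.\<close>

lemma (in prob_space) independent_rvs_nn_integral:
  assumes indep: "independent_rvs S X T Y"
    and \<phi>: "(\<lambda>(x, y). \<phi> x y) \<in> borel_measurable (S \<Otimes>\<^sub>M T)"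
  shows "(\<integral>\<^sup>+\<omega>. \<phi> (X \<omega>) (Y \<omega>) \<partial>M) = (\<integral>\<^sup>+\<omega>. \<integral>\<^sup>+y. \<phi> (X \<omega>) y \<partial>distr M T Y \<partial>M)"
proof -
  have X: "random_variable S X" and Y: "random_variable T Y"
    and D: "distr M (S \<Otimes>\<^sub>M T) (\<lambda>\<omega>. (X \<omega>, Y \<omega>)) = distr M S X \<Otimes>\<^sub>M distr M T Y"
    using indep by (auto simp: independent_rvs_def)
  interpret Y: prob_space "distr M T Y" using Y by (rule prob_space_distr)
  have \<phi>': "(\<lambda>(x, y). \<phi> x y) \<in> borel_measurable (distr M S X \<Otimes>\<^sub>M distr M T Y)"
    using \<phi> by simp
  have "(\<integral>\<^sup>+\<omega>. \<phi> (X \<omega>) (Y \<omega>) \<partial>M)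
      = (\<integral>\<^sup>+p. (case p of (x, y) \<Rightarrow> \<phi> x y) \<partial>distr M (S \<Otimes>\<^sub>M T) (\<lambda>\<omega>. (X \<omega>, Y \<omega>)))"
    using X Y \<phi> by (subst nn_integral_distr) auto
  also have "\<dots> = (\<integral>\<^sup>+x. \<integral>\<^sup>+y. \<phi> x y \<partial>distr M T Y \<partial>distr M S X)"
    unfolding D by (subst Y.nn_integral_fst[symmetric, OF \<phi>']) simp
  also have "\<dots> = (\<integral>\<^sup>+\<omega>. \<integral>\<^sup>+y. \<phi> (X \<omega>) y \<partial>distr M T Y \<partial>M)"
    using Y.borel_measurable_nn_integral_fst[OF \<phi>'] X by (subst nn_integral_distr) (auto simp: measurable_distr_eq1)
  finally show ?thesis .
qed

section \<open>Pathwise estimates\<close>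

lemma norm_add_sq_le:
  fixes u v :: "'a::real_inner"
  assumes "0 < c"
  shows "(norm (u + v))\<^sup>2 \<le> (1 + c) * (norm u)\<^sup>2 + (1 + 1 / c) * (norm v)\<^sup>2"
proof -
  have "0 \<le> (norm (c *\<^sub>R u - v))\<^sup>2 / c" using assms by simp
  also have "\<dots> = c * (norm u)\<^sup>2 + (norm v)\<^sup>2 / c - 2 * (u \<bullet> v)"
    using assms unfolding power2_norm_eq_inner
    by (simp add: inner_diff_left inner_diff_right inner_commute field_simps)
  finally show ?thesis
    unfolding power2_norm_eq_inner
    by (simp add: inner_add_left inner_add_right inner_commute algebra_simps)
qed

text \<open>Young's inequality with weight \<open>\<beta> / (1 - \<beta>)\<close>, chosen to use up
  one factor \<open>1 - \<beta>\<close> of the square so that a contraction remains; the other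
  weight becomes \<open>1 / \<beta>\<close>. For \<open>\<beta> = 1\<close> the weight would divide
  by zero, but the left side vanishes.\<close>

lemma norm_convex_combination_sq_le:
  fixes u v :: "'a::real_inner"
  assumes "0 < \<beta>" "\<beta> \<le> 1"
  shows "(1 - \<beta>)\<^sup>2 * (norm (u + v))\<^sup>2 \<le> (1 - \<beta>) * (norm u)\<^sup>2 + 1 / \<beta> * (norm v)\<^sup>2"
proof (cases "\<beta> = 1")
  case False
  with assms have \<beta>: "\<beta> < 1" by simp
  have "(1 - \<beta>)\<^sup>2 * (norm (u + v))\<^sup>2
      \<le> (1 - \<beta>)\<^sup>2 * ((1 + \<beta> / (1 - \<beta>)) * (norm u)\<^sup>2 + (1 + 1 / (\<beta> / (1 - \<beta>))) * (norm v)\<^sup>2)"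
    using assms \<beta> by (intro mult_left_mono norm_add_sq_le) auto
  also have "\<dots> = (1 - \<beta>) * (norm u)\<^sup>2 + (1 - \<beta>)\<^sup>2 * (1 / \<beta> * (norm v)\<^sup>2)"
  proof -
    have "1 + \<beta> / (1 - \<beta>) = 1 / (1 - \<beta>)" "1 + 1 / (\<beta> / (1 - \<beta>)) = 1 / \<beta>"
      using assms \<beta> by (auto simp: field_simps)
    then show ?thesis using \<beta> by (simp add: power2_eq_square distrib_left)
  qed
  also have "\<dots> \<le> (1 - \<beta>) * (norm u)\<^sup>2 + 1 * (1 / \<beta> * (norm v)\<^sup>2)"
    using assms by (intro add_left_mono mult_right_mono power_le_one) auto
  finally show ?thesis by simp
qed simp

section \<open>Orthogonal projections and the pathwise momentum error\<close>

definition orthogonal_projection :: "real ^ 'k ^ 'k::finite \<Rightarrow> bool" where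
  "orthogonal_projection A \<longleftrightarrow> transpose A = A \<and> A ** A = A"

context
  fixes A :: "real ^ 'k ^ 'k::finite"
  assumes A: "orthogonal_projection A"
begin

lemma orthogonal_projection_idem: "A *v (A *v u) = A *v u"
  using A by (simp add: orthogonal_projection_def matrix_vector_mul_assoc)

lemma orthogonal_projection_inner: "(A *v u) \<bullet> w = u \<bullet> (A *v w)"
  using A by (metis dot_lmul_matrix orthogonal_projection_def vector_transpose_matrix)

lemma orthogonal_projection_norm_sq: "(norm (A *v u))\<^sup>2 = u \<bullet> (A *v u)"
  by (simp add: power2_norm_eq_inner orthogonal_projection_inner orthogonal_projection_idem)

lemma orthogonal_projection_residual: "(norm (u - A *v u))\<^sup>2 = (norm u)\<^sup>2 - u \<bullet> (A *v u)"
  unfolding power2_norm_eq_inner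
  by (simp add: inner_diff_left inner_diff_right orthogonal_projection_inner
      orthogonal_projection_idem)

lemma orthogonal_projection_norm_le: "norm (A *v u) \<le> norm u"
proof -
  have "(norm (A *v u))\<^sup>2 \<le> (norm u)\<^sup>2"
    using orthogonal_projection_residual[of u] orthogonal_projection_norm_sq[of u]
      zero_le_power2[of "norm (u - A *v u)"] by linarith
  then show ?thesis by (rule power2_le_imp_le) simp
qed

lemma orthogonal_projection_residual_le: "norm (u - A *v u) \<le> norm u"
proof -
  have "(norm (u - A *v u))\<^sup>2 \<le> (norm u)\<^sup>2"
    using orthogonal_projection_residual[of u] orthogonal_projection_norm_sq[of u]
      zero_le_power2[of "norm (A *v u)"] by linarith
  then show ?thesis by (rule power2_le_imp_le) simp
qed

lemma orthogonal_projection_pythagoras: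
  assumes "A *v w = w"
  shows "(norm (w - u))\<^sup>2 = (norm (w - A *v u))\<^sup>2 + (norm (u - A *v u))\<^sup>2"
proof -
  have *: "w \<bullet> (A *v u) = w \<bullet> u" using assms by (metis orthogonal_projection_inner)
  show ?thesis
    unfolding power2_norm_eq_inner
    by (simp add: inner_diff_left inner_diff_right orthogonal_projection_inner inner_commute *
        orthogonal_projection_idem)
qed

end

text \<open>The comparison point is \<open>m - A' *v g\<close>: old subspace, new gradient. Passing
  to it from \<open>m - A' *v g'\<close> costs only the gradient change. If the projection is kept,
  it is exactly \<open>A *v (m - g)\<close>; if it is replaced, \<open>A\<close> is merely
  nonexpansive, and the Pythagorean split in the old subspace leaves the old outer residual, at most
  the whole gradient.\<close>

lemma projected_momentum_error_le:
  fixes A A' :: "real ^ 'k ^ 'k::finite"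
  assumes A: "orthogonal_projection A" and A': "orthogonal_projection A'"
    and m: "A' *v m = m" and \<beta>: "0 < \<beta>" "\<beta> \<le> 1" and same: "\<not> switch \<Longrightarrow> A = A'"
  shows "(1 - \<beta>)\<^sup>2 * (norm (A *v (m - g)))\<^sup>2
    \<le> (1 - \<beta>) * (norm (m - A' *v g'))\<^sup>2 + 1 / \<beta> * (norm (g - g'))\<^sup>2
      + (if switch then (norm g)\<^sup>2 else 0)"
proof -
  have "m - A' *v g = (m - A' *v g') + A' *v (g' - g)"
    by (simp add: matrix_vector_mult_diff_distrib)
  then have "(1 - \<beta>)\<^sup>2 * (norm (m - A' *v g))\<^sup>2
      \<le> (1 - \<beta>) * (norm (m - A' *v g'))\<^sup>2 + 1 / \<beta> * (norm (A' *v (g' - g)))\<^sup>2"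
    using norm_convex_combination_sq_le[OF \<beta>] by metis
  also have "\<dots> \<le> (1 - \<beta>) * (norm (m - A' *v g'))\<^sup>2 + 1 / \<beta> * (norm (g - g'))\<^sup>2"
    using \<beta> orthogonal_projection_norm_le[OF A', of "g' - g"]
    by (intro add_left_mono mult_left_mono power_mono) (auto simp: norm_minus_commute)
  finally have *: "(1 - \<beta>)\<^sup>2 * (norm (m - A' *v g))\<^sup>2
      \<le> (1 - \<beta>) * (norm (m - A' *v g'))\<^sup>2 + 1 / \<beta> * (norm (g - g'))\<^sup>2" .
  show ?thesis
  proof (cases switch)
    case False
    then show ?thesis using * same m by (simp add: matrix_vector_mult_diff_distrib)
  next
    case True
    have "(norm (A *v (m - g)))\<^sup>2 \<le> (norm (m - g))\<^sup>2"
      using orthogonal_projection_norm_le[OF A] by (intro power_mono) auto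
    also have "\<dots> \<le> (norm (m - A' *v g))\<^sup>2 + (norm g)\<^sup>2"
      using orthogonal_projection_pythagoras[OF A' m, of g]
        power_mono[OF orthogonal_projection_residual_le[OF A', of g], of 2] by simp
    finally have "(1 - \<beta>)\<^sup>2 * (norm (A *v (m - g)))\<^sup>2
        \<le> (1 - \<beta>)\<^sup>2 * (norm (m - A' *v g))\<^sup>2 + (1 - \<beta>)\<^sup>2 * (norm g)\<^sup>2"
      unfolding distrib_left[symmetric] by (rule mult_left_mono) simp
    moreover have "(1 - \<beta>)\<^sup>2 * (norm g)\<^sup>2 \<le> 1 * (norm g)\<^sup>2"
      using \<beta> by (intro mult_right_mono power_le_one) auto
    ultimately show ?thesis using * True by simp
  qed
qed

section \<open>Drift and descent along one trajectory\<close>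

lemma drift_sq_le:
  fixes x m :: "nat \<Rightarrow> 'a::real_inner"
  assumes step: "\<And>t. x (Suc t) = x t - \<eta> *\<^sub>R m (Suc t)" and "s \<le> t"
  shows "(norm (x t - x s))\<^sup>2 \<le> real (t - s) * (\<eta>\<^sup>2 * (\<Sum>j\<in>{s..<t}. (norm (m (Suc j)))\<^sup>2))"
proof -
  have "x t - x s = (\<Sum>j\<in>{s..<t}. x (Suc j) - x j)"
    using \<open>s \<le> t\<close> by (simp add: sum_Suc_diff')
  then have "norm (x t - x s) \<le> (\<Sum>j\<in>{s..<t}. \<bar>\<eta>\<bar> * norm (m (Suc j)))"
    using norm_sum[of "\<lambda>j. x (Suc j) - x j" "{s..<t}"] by (simp add: step)
  then have "(norm (x t - x s))\<^sup>2 \<le> (\<Sum>j\<in>{s..<t}. \<bar>\<eta>\<bar> * norm (m (Suc j)))\<^sup>2"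
    by (intro power_mono) auto
  also have "\<dots> \<le> (\<Sum>j\<in>{s..<t}. (\<bar>\<eta>\<bar> * norm (m (Suc j)))\<^sup>2) * (\<Sum>j\<in>{s..<t}. 1\<^sup>2)"
    using Cauchy_Schwarz_ineq_sum[of "\<lambda>j. \<bar>\<eta>\<bar> * norm (m (Suc j))" "\<lambda>_. 1" "{s..<t}"] by simp
  finally show ?thesis
    by (simp add: power_mult_distrib sum_distrib_left mult.commute)
qed

text \<open>Polarisation turns the inner product in the descent lemma into squares of gradient,
  momentum and error. The step-size bound charges a quarter of the squared momentum to curvature;
  the remaining \<open>3 / 4\<close> is the budget for the drift terms.\<close>

lemma momentum_descent_sum:
  fixes f :: "'a::euclidean_space \<Rightarrow> real"
  assumes deriv: "\<And>x. (f has_derivative (\<lambda>h. g x \<bullet> h)) (at x)"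
    and lip: "\<And>x y. norm (g x - g y) \<le> L * norm (x - y)"
    and bdd: "bdd_below (range f)"
    and step: "\<And>t. x (Suc t) = x t - \<eta> *\<^sub>R m (Suc t)"
    and \<eta>: "0 < \<eta>" "\<eta> * L \<le> 1 / 4"
  shows "(\<Sum>t<T. (norm (g (x t)))\<^sup>2) + 3 / 4 * (\<Sum>t<T. (norm (m (Suc t)))\<^sup>2)
    \<le> 2 * (f (x 0) - Inf (range f)) / \<eta> + (\<Sum>t<T. (norm (m (Suc t) - g (x t)))\<^sup>2)"
proof -
  have one: "(norm (g (x t)))\<^sup>2 + 3 / 4 * (norm (m (Suc t)))\<^sup>2
      \<le> 2 * (f (x t) - f (x (Suc t))) / \<eta> + (norm (m (Suc t) - g (x t)))\<^sup>2" for t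
  proof -
    let ?m = "m (Suc t)" and ?g = "g (x t)"
    have "f (x (Suc t)) \<le> f (x t) + ?g \<bullet> (- \<eta> *\<^sub>R ?m) + L / 2 * (norm (- \<eta> *\<^sub>R ?m))\<^sup>2"
      using lipschitz_gradient_upper_bound[OF deriv lip, of "x t" "- \<eta> *\<^sub>R ?m"] by (simp add: step)
    also have "\<dots> = f (x t) - \<eta> * (?g \<bullet> ?m) + \<eta> * (\<eta> * L) / 2 * (norm ?m)\<^sup>2"
      by (simp add: power_mult_distrib power2_eq_square)
    also have "\<dots> \<le> f (x t) - \<eta> * (?g \<bullet> ?m) + \<eta> * (1 / 4) / 2 * (norm ?m)\<^sup>2"
      using \<eta> by (intro add_left_mono mult_right_mono divide_right_mono mult_left_mono) auto
    finally have "2 * (?g \<bullet> ?m) - (norm ?m)\<^sup>2 / 4 \<le> 2 * (f (x t) - f (x (Suc t))) / \<eta>"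
      using \<eta> by (simp add: field_simps)
    moreover have "(norm (?m - ?g))\<^sup>2 = (norm ?m)\<^sup>2 + (norm ?g)\<^sup>2 - 2 * (?g \<bullet> ?m)"
      unfolding power2_norm_eq_inner by (simp add: inner_diff_left inner_diff_right inner_commute)
    ultimately show ?thesis by linarith
  qed
  have "(\<Sum>t<T. (norm (g (x t)))\<^sup>2) + 3 / 4 * (\<Sum>t<T. (norm (m (Suc t)))\<^sup>2)
      = (\<Sum>t<T. (norm (g (x t)))\<^sup>2 + 3 / 4 * (norm (m (Suc t)))\<^sup>2)"
    by (simp add: sum.distrib sum_distrib_left)
  also have "\<dots> \<le> (\<Sum>t<T. 2 * (f (x t) - f (x (Suc t))) / \<eta> + (norm (m (Suc t) - g (x t)))\<^sup>2)"
    by (intro sum_mono one)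
  also have "\<dots> = 2 * (f (x 0) - f (x T)) / \<eta> + (\<Sum>t<T. (norm (m (Suc t) - g (x t)))\<^sup>2)"
  proof -
    have "(\<Sum>t<T. 2 * (f (x t) - f (x (Suc t))) / \<eta>) = 2 * (f (x 0) - f (x T)) / \<eta>"
      by (induction T) (auto simp: diff_divide_distrib)
    then show ?thesis by (simp add: sum.distrib)
  qed
  also have "\<dots> \<le> 2 * (f (x 0) - Inf (range f)) / \<eta> + (\<Sum>t<T. (norm (m (Suc t) - g (x t)))\<^sup>2)"
    using \<eta> cInf_lower[OF _ bdd, of "f (x T)"]
    by (intro add_right_mono divide_right_mono mult_left_mono) auto
  finally show ?thesis .
qed

section \<open>Sums over periods and the deterministic rate\<close>

lemma sum_period_start:
  fixes u :: "nat \<Rightarrow> real"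
  assumes "0 < \<tau>"
  shows "(\<Sum>t<K * \<tau>. u (t div \<tau> * \<tau>)) = real \<tau> * (\<Sum>t<K * \<tau>. if \<tau> dvd t then u t else 0)"
proof -
  have "(\<Sum>t\<in>{k * \<tau>..<k * \<tau> + \<tau>}. u (t div \<tau> * \<tau>))
      = real \<tau> * (\<Sum>t\<in>{k * \<tau>..<k * \<tau> + \<tau>}. if \<tau> dvd t then u t else 0)" for k
  proof -
    have d: "t div \<tau> = k" if "t \<in> {k * \<tau>..<k * \<tau> + \<tau>}" for t
      using that by (intro div_nat_eqI) (auto simp: mult.commute)
    have "(\<Sum>t\<in>{k * \<tau>..<k * \<tau> + \<tau>}. u (t div \<tau> * \<tau>)) = (\<Sum>t\<in>{k * \<tau>..<k * \<tau> + \<tau>}. u (k * \<tau>))"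
      using d by (intro sum.cong) auto
    moreover have "(\<Sum>t\<in>{k * \<tau>..<k * \<tau> + \<tau>}. if \<tau> dvd t then u t else 0)
        = (\<Sum>t\<in>{k * \<tau>..<k * \<tau> + \<tau>}. if t = k * \<tau> then u t else 0)"
    proof (intro sum.cong refl)
      fix t assume "t \<in> {k * \<tau>..<k * \<tau> + \<tau>}"
      then have "\<tau> dvd t \<longleftrightarrow> t = k * \<tau>" using d by (metis dvd_div_mult_self dvd_triv_right)
      then show "(if \<tau> dvd t then u t else 0) = (if t = k * \<tau> then u t else 0)" by simp
    qed
    ultimately show ?thesis using assms by (simp add: sum.delta)
  qed
  then show ?thesis by (simp add: sum_distrib_left flip: sum.nat_group)
qed

text \<open>Each inner window is enlarged to its whole period, which is then counted
  \<open>\<tau>\<close> times. Together with the factor \<open>\<tau>\<close> that Cauchy-Schwarz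
  puts into the drift, this produces the \<open>(real \<tau>)\<^sup>2\<close> of the step-size
  condition.\<close>

lemma sum_period_window:
  fixes y :: "nat \<Rightarrow> real"
  assumes \<tau>: "0 < \<tau>" and y: "\<And>t. 0 \<le> y t"
  shows "(\<Sum>t<K * \<tau>. \<Sum>j\<in>{t div \<tau> * \<tau>..<t}. y j) \<le> real \<tau> * (\<Sum>t<K * \<tau>. y t)"
proof -
  have "(\<Sum>t\<in>{k * \<tau>..<k * \<tau> + \<tau>}. \<Sum>j\<in>{t div \<tau> * \<tau>..<t}. y j)
      \<le> real \<tau> * (\<Sum>t\<in>{k * \<tau>..<k * \<tau> + \<tau>}. y t)" for k
  proof -
    have d: "t div \<tau> = k" if "t \<in> {k * \<tau>..<k * \<tau> + \<tau>}" for t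
      using that by (intro div_nat_eqI) (auto simp: mult.commute)
    have "(\<Sum>t\<in>{k * \<tau>..<k * \<tau> + \<tau>}. \<Sum>j\<in>{t div \<tau> * \<tau>..<t}. y j)
        \<le> (\<Sum>t\<in>{k * \<tau>..<k * \<tau> + \<tau>}. \<Sum>j\<in>{k * \<tau>..<k * \<tau> + \<tau>}. y j)"
      using d y by (intro sum_mono sum_mono2) auto
    then show ?thesis by simp
  qed
  then show ?thesis
    unfolding sum.nat_group[symmetric] sum_distrib_left[of "real \<tau>" _ "{..<K}"] by (intro sum_mono)
qed

text \<open>The sequences are the expectations of the squared norms of the gradient, of the momentum, of
  the momentum error inside the current subspace, of the gradient component outside it, and of the
  drift of the gradient since the start of the period.\<close>

lemma subspace_momentum_rate:
  fixes G Y a b R :: "nat \<Rightarrow> real"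
  assumes G: "\<And>t. 0 \<le> G t" and Y: "\<And>t. 0 \<le> Y t" and a: "\<And>t. 0 \<le> a t" and R: "\<And>t. 0 \<le> R t"
    and a0: "a 0 \<le> G 0 + \<beta>\<^sup>2 * v"
    and aS: "\<And>t. a (Suc t) \<le> (1 - \<beta>) * a t + 1 / \<beta> * (L\<^sup>2 * \<eta>\<^sup>2 * Y t)
        + (if \<tau> dvd Suc t then G (Suc t) else 0) + \<beta>\<^sup>2 * v"
    and b: "\<And>t. b t \<le> (1 + \<delta> / 4) * ((1 - \<delta>) * G (t div \<tau> * \<tau>)) + (1 + 1 / (\<delta> / 4)) * R t"
    and GR: "\<And>t c. 0 < c \<Longrightarrow> G (t div \<tau> * \<tau>) \<le> (1 + c) * G t + (1 + 1 / c) * R t"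
    and RY: "\<And>t. R t \<le> L\<^sup>2 * (real \<tau> * (\<eta>\<^sup>2 * (\<Sum>j\<in>{t div \<tau> * \<tau>..<t}. Y j)))"
    and descent: "(\<Sum>t<K * \<tau>. G t) + 3 / 4 * (\<Sum>t<K * \<tau>. Y t) \<le> 2 * \<Delta> / \<eta> + (\<Sum>t<K * \<tau>. a t + b t)"
    and \<delta>: "0 < \<delta>" "\<delta> \<le> 1" and \<beta>: "0 < \<beta>" "\<beta> \<le> 1" and v: "0 \<le> v"
    and \<tau>: "64 / (3 * \<beta> * \<delta>) \<le> real \<tau>"
    and \<eta>: "0 < \<eta>" "L\<^sup>2 * \<eta>\<^sup>2 \<le> 3 * \<delta> * \<beta>\<^sup>2 / 80" "L\<^sup>2 * \<eta>\<^sup>2 * (real \<tau>)\<^sup>2 \<le> 3 * \<delta> / 80"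
    and \<Delta>: "0 \<le> \<Delta>"
  shows "(\<Sum>t<K * \<tau>. G t) \<le> 16 * \<Delta> / (\<delta> * \<eta>) + real (K * \<tau>) * (32 * \<beta> * v / (3 * \<delta>))"
proof -
  define T where "T = K * \<tau>"
  define q where "q = L\<^sup>2 * \<eta>\<^sup>2"
  define SG where "SG = (\<Sum>t<T. G t)"
  define SY where "SY = (\<Sum>t<T. Y t)"
  define Sa where "Sa = (\<Sum>t<T. a t)"
  define Sb where "Sb = (\<Sum>t<T. b t)"
  define SR where "SR = (\<Sum>t<T. R t)"
  define SD where "SD = (\<Sum>t<T. if \<tau> dvd t then G t else 0)"
  have q: "0 \<le> q" by (simp add: q_def)
  have SG0: "0 \<le> SG" and SY0: "0 \<le> SY" and SR0: "0 \<le> SR"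
    using G Y R by (auto simp: SG_def SY_def SR_def intro: sum_nonneg)
  have "0 < 64 / (3 * \<beta> * \<delta>)" using \<delta> \<beta> by simp
  then have "0 < real \<tau>" using \<tau> by linarith
  then have \<tau>0: "0 < \<tau>" by simp
  have SD: "(\<Sum>t<T. G (t div \<tau> * \<tau>)) = real \<tau> * SD"
    unfolding T_def SD_def by (rule sum_period_start[OF \<tau>0])
  have SR: "SR \<le> q * (real \<tau>)\<^sup>2 * SY"
  proof -
    have "SR \<le> (\<Sum>t<T. q * real \<tau> * (\<Sum>j\<in>{t div \<tau> * \<tau>..<t}. Y j))"
      unfolding SR_def q_def using RY by (intro sum_mono) (simp add: mult_ac)
    also have "\<dots> = q * real \<tau> * (\<Sum>t<T. \<Sum>j\<in>{t div \<tau> * \<tau>..<t}. Y j)"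
      by (simp add: sum_distrib_left)
    also have "\<dots> \<le> q * real \<tau> * (real \<tau> * SY)"
      unfolding SY_def T_def using q by (intro mult_left_mono sum_period_window[OF \<tau>0 Y]) auto
    finally show ?thesis by (simp add: power2_eq_square mult_ac)
  qed
  have GR_sum: "real \<tau> * SD \<le> (1 + c) * SG + (1 + 1 / c) * SR" if "0 < c" for c
    unfolding SD[symmetric] SG_def SR_def sum_distrib_left sum.distrib[symmetric]
    using GR[OF that] by (intro sum_mono)
  \<comment> \<open>When the recursion is summed, the copy \<open>(1 - \<beta>) * Sa\<close> on the
    right is absorbed, leaving \<open>\<beta> * Sa\<close>. The initial bound fits the pattern
    because \<open>\<tau>\<close> divides 0, so \<open>G 0\<close> is the first term of
    \<open>SD\<close>.\<close>
  have Sa: "\<beta> * Sa \<le> 1 / \<beta> * (q * SY) + SD + real T * (\<beta>\<^sup>2 * v)"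
  proof (cases T)
    case 0
    then show ?thesis by (simp add: Sa_def SY_def SD_def)
  next
    case (Suc N)
    have ind: "(\<Sum>t<Suc N. a t) \<le> (1 - \<beta>) * (\<Sum>t<N. a t) + 1 / \<beta> * (q * (\<Sum>t<N. Y t))
          + (\<Sum>t<Suc N. if \<tau> dvd t then G t else 0) + real (Suc N) * (\<beta>\<^sup>2 * v)" for N
    proof (induction N)
      case 0
      then show ?case using a0 by simp
    next
      case (Suc N)
      then show ?case using aS[of N] by (simp add: q_def algebra_simps)
    qed
    have "(1 - \<beta>) * (\<Sum>t<N. a t) \<le> (1 - \<beta>) * Sa"
      unfolding Sa_def Suc using \<beta> a by (intro mult_left_mono) auto
    moreover have "1 / \<beta> * (q * (\<Sum>t<N. Y t)) \<le> 1 / \<beta> * (q * SY)"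
      unfolding SY_def Suc using \<beta> q Y by (intro mult_left_mono) auto
    ultimately have "Sa \<le> (1 - \<beta>) * Sa + 1 / \<beta> * (q * SY) + SD + real T * (\<beta>\<^sup>2 * v)"
      using ind[of N] unfolding Sa_def[unfolded Suc] SD_def[unfolded Suc] Suc by linarith
    then show ?thesis by (simp add: algebra_simps)
  qed
  have SR': "SR \<le> 3 * \<delta> / 80 * SY"
    using SR mult_right_mono[OF \<eta>(3)[folded q_def] SY0] by linarith
  have "Sa \<le> q * SY / \<beta>\<^sup>2 + SD / \<beta> + real T * (\<beta> * v)"
    using Sa \<beta> by (simp add: field_simps power2_eq_square)
  moreover have "q * SY / \<beta>\<^sup>2 \<le> 3 / 80 * SY"
  proof -
    have "q * SY \<le> 3 * \<delta> * \<beta>\<^sup>2 / 80 * SY"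
      using mult_right_mono[OF \<eta>(2)[folded q_def] SY0] by simp
    also have "\<dots> \<le> 3 * 1 * \<beta>\<^sup>2 / 80 * SY"
      using \<delta> SY0 by (intro mult_right_mono divide_right_mono mult_left_mono) auto
    finally show ?thesis using \<beta> by (simp add: divide_simps mult_ac)
  qed
  \<comment> \<open>\<open>SD\<close> holds one gradient per period, so up to drift it is of size
    \<open>SG / real \<tau>\<close>; the Young weight 1 gives the factor 2. The lower bound on
    \<open>\<tau>\<close> bounds \<open>1 / (\<beta> * real \<tau>)\<close> by
    \<open>3 * \<delta> / 64\<close>, and \<open>9 / 2560\<close> is
    \<open>3 / 32 * (3 / 80)\<close>.\<close>
  moreover have "SD / \<beta> \<le> 3 * \<delta> / 32 * SG + 9 / 2560 * SY"
  proof -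
    have "1 / (\<beta> * real \<tau>) \<le> 3 * \<delta> / 64"
      using \<tau> \<tau>0 \<beta> \<delta> by (simp add: field_simps)
    moreover have "SD / \<beta> = 1 / (\<beta> * real \<tau>) * (real \<tau> * SD)" using \<tau>0 by simp
    moreover have "1 / (\<beta> * real \<tau>) * (real \<tau> * SD) \<le> 1 / (\<beta> * real \<tau>) * (2 * SG + 2 * SR)"
      using GR_sum[of 1] \<beta> by (intro mult_left_mono) auto
    moreover have "1 / (\<beta> * real \<tau>) * (2 * SG + 2 * SR) \<le> 3 * \<delta> / 64 * (2 * SG + 2 * SR)"
      using SG0 SR0 calculation(1) by (intro mult_right_mono) auto
    ultimately have "SD / \<beta> \<le> 3 * \<delta> / 64 * (2 * SG + 2 * SR)" by linarith
    also have "\<dots> = 3 * \<delta> / 32 * SG + 3 / 32 * (\<delta> * SR)" by (simp add: algebra_simps)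
    also have "\<delta> * SR \<le> 1 * SR" using \<delta> SR0 by (intro mult_right_mono) auto
    also have "SR \<le> 3 / 80 * SY"
      using SR' \<delta> SY0 mult_right_mono[of "3 * \<delta> / 80" "3 / 80" SY] by linarith
    finally show ?thesis by simp
  qed
  \<comment> \<open>With weight \<open>\<delta> / 4\<close> both Young steps keep a strict loss: the
    factor \<open>1 - \<delta>\<close> grows to \<open>1 - 3 * \<delta> / 4\<close> and then to
    \<open>1 - \<delta> / 2\<close>. Each leaves a drift factor \<open>1 + 4 / \<delta>\<close>, at
    most \<open>5 / \<delta>\<close>; the step-size bound cancels the \<open>1 / \<delta>\<close>,
    giving \<open>2 * (5 / \<delta>) * (3 * \<delta> / 80) = 3 / 8\<close>.\<close>
  moreover have "Sb \<le> (1 - \<delta> / 2) * SG + 3 / 8 * SY"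
  proof -
    have c: "(1 + \<delta> / 4) * (1 - \<delta>) \<le> 1 - 3 * \<delta> / 4" "(1 - 3 * \<delta> / 4) * (1 + \<delta> / 4) \<le> 1 - \<delta> / 2"
      using \<delta> by (auto simp: field_simps)
    have SD0: "0 \<le> real \<tau> * SD" unfolding SD[symmetric] using G by (intro sum_nonneg)
    have "Sb \<le> (\<Sum>t<T. (1 + \<delta> / 4) * ((1 - \<delta>) * G (t div \<tau> * \<tau>)) + (1 + 1 / (\<delta> / 4)) * R t)"
      unfolding Sb_def by (intro sum_mono b)
    also have "\<dots> = (1 + \<delta> / 4) * (1 - \<delta>) * (real \<tau> * SD) + (1 + 1 / (\<delta> / 4)) * SR"
      unfolding SD[symmetric] SR_def by (simp add: sum.distrib sum_distrib_left mult.assoc)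
    also have "\<dots> \<le> (1 - 3 * \<delta> / 4) * (real \<tau> * SD) + (1 + 1 / (\<delta> / 4)) * SR"
      using c SD0 by (intro add_right_mono mult_right_mono)
    also have "\<dots> \<le> (1 - 3 * \<delta> / 4) * ((1 + \<delta> / 4) * SG + (1 + 1 / (\<delta> / 4)) * SR) + (1 + 1 / (\<delta> / 4)) * SR"
      using \<delta> by (intro add_right_mono mult_left_mono GR_sum) auto
    also have "\<dots> = (1 - 3 * \<delta> / 4) * (1 + \<delta> / 4) * SG + (1 + (1 - 3 * \<delta> / 4)) * ((1 + 1 / (\<delta> / 4)) * SR)"
    proof -
      have "u * (p * SG + w) + w = u * p * SG + (1 + u) * w" for u p w :: real
        by (simp add: algebra_simps)
      then show ?thesis .
    qed
    also have "\<dots> \<le> (1 - \<delta> / 2) * SG + 2 * (5 / \<delta> * SR)"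
      using c \<delta> SG0 SR0 by (intro add_mono mult_right_mono mult_mono) (auto simp: field_simps)
    also have "5 / \<delta> * SR \<le> 3 / 16 * SY"
      using SR' \<delta> by (simp add: field_simps)
    finally show ?thesis by simp
  qed
  moreover have "SG + 3 / 4 * SY \<le> 2 * \<Delta> / \<eta> + (Sa + Sb)"
    using descent unfolding SG_def SY_def Sa_def Sb_def T_def by (simp add: sum.distrib)
  moreover have "(1 - \<delta> / 2) * SG = SG - \<delta> * SG / 2" "3 * \<delta> / 32 * SG = 3 / 32 * (\<delta> * SG)"
    by (auto simp: algebra_simps)
  ultimately have "13 / 32 * (\<delta> * SG) \<le> 2 * (\<Delta> / \<eta>) + real T * (\<beta> * v)"
    using SY0 by simp
  moreover have "0 \<le> \<Delta> / \<eta>" "0 \<le> real T * (\<beta> * v)" using \<Delta> \<eta> \<beta> v by auto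
  ultimately have "\<delta> * SG \<le> 16 * (\<Delta> / \<eta>) + 32 / 3 * (real T * (\<beta> * v))" by linarith
  then have "SG \<le> (16 * (\<Delta> / \<eta>) + 32 / 3 * (real T * (\<beta> * v))) / \<delta>"
    using \<delta> by (simp add: pos_le_divide_eq mult.commute)
  also have "\<dots> = 16 * \<Delta> / (\<delta> * \<eta>) + real T * (32 * \<beta> * v / (3 * \<delta>))"
    using \<delta> \<eta> by (simp add: field_simps)
  finally show ?thesis unfolding SG_def T_def .
qed

section \<open>Stochastic momentum in random subspaces\<close>

lemma borel_measurable_matrix_vector_mult [measurable (raw)]:
  fixes A :: "'a \<Rightarrow> real ^ 'n::finite ^ 'm::finite"
  assumes "A \<in> borel_measurable M" "u \<in> borel_measurable M"
  shows "(\<lambda>\<omega>. A \<omega> *v u \<omega>) \<in> borel_measurable M"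
  using assms(1,2)
proof (rule borel_measurable_continuous_Pair)
  show "continuous_on UNIV (\<lambda>p :: (real ^ 'n ^ 'm) \<times> (real ^ 'n). fst p *v snd p)"
    unfolding matrix_vector_mult_def
    by (intro continuous_on_vec_lambda continuous_intros)
qed

lemma lipschitz_borel_measurable:
  fixes g :: "'a::euclidean_space \<Rightarrow> 'b::real_normed_vector"
  assumes "\<And>x y. norm (g x - g y) \<le> L * norm (x - y)"
  shows "g \<in> borel_measurable borel"
proof (rule borel_measurable_continuous_onI)
  have "(max L 0)-lipschitz_on UNIV g"
  proof (rule lipschitz_onI)
    fix x y :: 'a
    have "L * norm (x - y) \<le> max L 0 * norm (x - y)" by (intro mult_right_mono) auto
    then show "dist (g x) (g y) \<le> max L 0 * dist x y"
      using assms[of x y] by (simp add: dist_norm)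
  qed simp
  then show "continuous_on UNIV g" by (rule lipschitz_on_continuous_on)
qed

section \<open>Square-integrable random vectors\<close>

definition square_integrable :: "'a measure \<Rightarrow> ('a \<Rightarrow> 'b::euclidean_space) \<Rightarrow> bool" where
  "square_integrable M X \<longleftrightarrow> X \<in> borel_measurable M \<and> integrable M (\<lambda>\<omega>. (norm (X \<omega>))\<^sup>2)"

lemma square_integrable_measurable: "square_integrable M X \<Longrightarrow> X \<in> borel_measurable M"
  and square_integrable_norm_sq: "square_integrable M X \<Longrightarrow> integrable M (\<lambda>\<omega>. (norm (X \<omega>))\<^sup>2)"
  by (auto simp: square_integrable_def)

lemma square_integrable_bound:
  assumes "integrable M h" "X \<in> borel_measurable M" "AE \<omega> in M. (norm (X \<omega>))\<^sup>2 \<le> h \<omega>"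
  shows "square_integrable M X"
  unfolding square_integrable_def using assms
  by (auto intro!: Bochner_Integration.integrable_bound[OF assms(1)])

lemma square_integrable_scaleR:
  "square_integrable M X \<Longrightarrow> square_integrable M (\<lambda>\<omega>. c *\<^sub>R X \<omega>)"
  by (auto simp: square_integrable_def power_mult_distrib)

lemma square_integrable_add:
  assumes "square_integrable M X" "square_integrable M Y"
  shows "square_integrable M (\<lambda>\<omega>. X \<omega> + Y \<omega>)"
  using norm_add_sq_le[of 1] assms
  by (intro square_integrable_bound[where h = "\<lambda>\<omega>. (1 + 1) * (norm (X \<omega>))\<^sup>2 + (1 + 1 / 1) * (norm (Y \<omega>))\<^sup>2"])
    (auto simp: square_integrable_def)

lemma square_integrable_diff:
  assumes "square_integrable M X" "square_integrable M Y"
  shows "square_integrable M (\<lambda>\<omega>. X \<omega> - Y \<omega>)"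
  using square_integrable_add[OF assms(1) square_integrable_scaleR[OF assms(2), of "-1"]] by simp

lemma square_integrable_projection:
  assumes "square_integrable M X" "A \<in> borel_measurable M" "AE \<omega> in M. orthogonal_projection (A \<omega>)"
  shows "square_integrable M (\<lambda>\<omega>. A \<omega> *v X \<omega>)"
  using assms(1,2)
  by (intro square_integrable_bound[OF square_integrable_norm_sq[OF assms(1)]])
    (auto dest: square_integrable_measurable intro: eventually_mono[OF assms(3)] intro!: power_mono orthogonal_projection_norm_le)

lemma square_integrable_lipschitz:
  assumes "finite_measure M" "square_integrable M X" and lip: "\<And>x y. norm (g x - g y) \<le> L * norm (x - y)"
  shows "square_integrable M (\<lambda>\<omega>. g (X \<omega>))"
proof -
  interpret finite_measure M by fact
  have X: "X \<in> borel_measurable M" using assms(2) by (rule square_integrable_measurable)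
  note g = lipschitz_borel_measurable[OF lip]
  have "(norm (g (X \<omega>) - g 0))\<^sup>2 \<le> L\<^sup>2 * (norm (X \<omega>))\<^sup>2" for \<omega>
    using power_mono[OF lip[of "X \<omega>" 0], of 2] by (simp add: power_mult_distrib)
  then have "square_integrable M (\<lambda>\<omega>. g (X \<omega>) - g 0)"
    using measurable_compose[OF X g] assms(2)
    by (intro square_integrable_bound[where h = "\<lambda>\<omega>. L\<^sup>2 * (norm (X \<omega>))\<^sup>2"])
      (auto simp: square_integrable_def)
  moreover have "square_integrable M (\<lambda>\<omega>. g 0)" by (auto simp: square_integrable_def)
  ultimately show ?thesis using square_integrable_add by fastforce
qed

text \<open>In the expanded square the cross term is linear in \<open>Z\<close> and integrates to
  zero, \<open>A\<close> being moved onto \<open>w\<close> by symmetry. The noise is not amplified,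
  as \<open>A\<close> is nonexpansive, and the variance bound also supplies its square
  integrability.\<close>

lemma centered_noise_norm_sq_le:
  fixes Z :: "'a \<Rightarrow> real ^ 'k::finite"
  assumes "prob_space D" and A: "orthogonal_projection A"
    and Z: "integrable D Z" "(\<integral>y. Z y \<partial>D) = 0"
    and var: "(\<integral>\<^sup>+y. ennreal ((norm (Z y))\<^sup>2) \<partial>D) \<le> ennreal v" and v: "0 \<le> v"
  shows "(\<integral>\<^sup>+y. ennreal ((norm (w + \<beta> *\<^sub>R (A *v Z y)))\<^sup>2) \<partial>D) \<le> ennreal ((norm w)\<^sup>2 + \<beta>\<^sup>2 * v)"
proof -
  interpret prob_space D by fact
  have [measurable]: "Z \<in> borel_measurable D" using Z by auto
  have Z2: "integrable D (\<lambda>y. (norm (Z y))\<^sup>2)"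
    using var by (intro integrableI_bounded) (auto simp: le_less_trans[OF _ ennreal_less_top])
  have "ennreal (\<integral>y. (norm (Z y))\<^sup>2 \<partial>D) \<le> ennreal v"
    using var Z2 by (simp add: nn_integral_eq_integral)
  then have Z2v: "(\<integral>y. (norm (Z y))\<^sup>2 \<partial>D) \<le> v" using v by simp
  have le: "(norm (w + \<beta> *\<^sub>R (A *v Z y)))\<^sup>2
      \<le> (norm w)\<^sup>2 + 2 * \<beta> * ((A *v w) \<bullet> Z y) + \<beta>\<^sup>2 * (norm (Z y))\<^sup>2" for y
  proof -
    have "(norm (w + \<beta> *\<^sub>R (A *v Z y)))\<^sup>2
        = (norm w)\<^sup>2 + 2 * \<beta> * ((A *v w) \<bullet> Z y) + \<beta>\<^sup>2 * (norm (A *v Z y))\<^sup>2"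
      unfolding orthogonal_projection_inner[OF A, of w] power2_norm_eq_inner
      by (simp add: inner_add_left inner_add_right inner_commute power2_eq_square algebra_simps)
    also have "(norm (A *v Z y))\<^sup>2 \<le> (norm (Z y))\<^sup>2"
      by (intro power_mono orthogonal_projection_norm_le A) auto
    finally show ?thesis by (simp add: mult_left_mono)
  qed
  have int: "integrable D (\<lambda>y. (norm w)\<^sup>2 + 2 * \<beta> * ((A *v w) \<bullet> Z y) + \<beta>\<^sup>2 * (norm (Z y))\<^sup>2)"
    using Z Z2 by auto
  have "(\<integral>\<^sup>+y. ennreal ((norm (w + \<beta> *\<^sub>R (A *v Z y)))\<^sup>2) \<partial>D)
      \<le> (\<integral>\<^sup>+y. ennreal ((norm w)\<^sup>2 + 2 * \<beta> * ((A *v w) \<bullet> Z y) + \<beta>\<^sup>2 * (norm (Z y))\<^sup>2) \<partial>D)"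
    by (intro nn_integral_mono ennreal_leI le)
  also have "\<dots> = ennreal (\<integral>y. (norm w)\<^sup>2 + 2 * \<beta> * ((A *v w) \<bullet> Z y) + \<beta>\<^sup>2 * (norm (Z y))\<^sup>2 \<partial>D)"
    using order_trans[OF zero_le_power2 le] by (intro nn_integral_eq_integral int) auto
  also have "(\<integral>y. (norm w)\<^sup>2 + 2 * \<beta> * ((A *v w) \<bullet> Z y) + \<beta>\<^sup>2 * (norm (Z y))\<^sup>2 \<partial>D)
      = (norm w)\<^sup>2 + \<beta>\<^sup>2 * (\<integral>y. (norm (Z y))\<^sup>2 \<partial>D)"
    using Z Z2 by (simp add: prob_space)
  also have "\<dots> \<le> (norm w)\<^sup>2 + \<beta>\<^sup>2 * v" using Z2v by (simp add: mult_left_mono)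
  finally show ?thesis by (simp add: ennreal_leI)
qed

text \<open>What the analysis needs from the algorithm, free of layers and frames.
  \<open>m (Suc t)\<close> is the momentum formed in step \<open>t\<close>, so \<open>m 0\<close> is
  the zero momentum before the first step. \<open>indep_xi\<close> keeps
  \<open>A (t div \<tau>)\<close> on the side of the past, because at a period start it is drawn
  together with the sample; \<open>indep_A\<close> speaks only of the iterate at the period start,
  as later iterates depend on \<open>A k\<close>.\<close>

locale subspace_momentum = prob_space M for M :: "'w measure" +
  fixes D :: "'xi measure" and gF :: "real ^ 'k::finite \<Rightarrow> 'xi \<Rightarrow> real ^ 'k"
    and gradf :: "real ^ 'k \<Rightarrow> real ^ 'k" and L v \<beta> \<eta> \<delta> :: real and \<tau> :: nat
    and xi :: "nat \<Rightarrow> 'w \<Rightarrow> 'xi" and A :: "nat \<Rightarrow> 'w \<Rightarrow> real ^ 'k ^ 'k"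
    and x0 :: "real ^ 'k" and x m :: "nat \<Rightarrow> 'w \<Rightarrow> real ^ 'k"
  assumes x_0: "x 0 \<omega> = x0" and m_0: "m 0 \<omega> = 0"
    and m_Suc: "m (Suc t) \<omega> = A (t div \<tau>) \<omega> *v ((1 - \<beta>) *\<^sub>R m t \<omega> + \<beta> *\<^sub>R gF (x t \<omega>) (xi t \<omega>))"
    and x_Suc: "x (Suc t) \<omega> = x t \<omega> - \<eta> *\<^sub>R m (Suc t) \<omega>"
    and D: "prob_space D" and xi_distr: "distr M D (xi t) = D"
    and gF_measurable: "(\<lambda>(z, y). gF z y) \<in> borel_measurable (borel \<Otimes>\<^sub>M D)"
    and gF_mean: "integrable D (gF z)" "(\<integral>y. gF z y \<partial>D) = gradf z"
    and gF_var: "(\<integral>\<^sup>+y. ennreal ((norm (gF z y - gradf z))\<^sup>2) \<partial>D) \<le> ennreal v"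
    and v: "0 \<le> v"
    and lip: "norm (gradf y - gradf z) \<le> L * norm (y - z)"
    and proj: "AE \<omega> in M. orthogonal_projection (A k \<omega>)"
    and proj_mean: "(\<integral>\<^sup>+\<omega>. ennreal ((norm (u - A k \<omega> *v u))\<^sup>2) \<partial>M) \<le> ennreal ((1 - \<delta>) * (norm u)\<^sup>2)"
    and indep_xi: "independent_rvs (borel \<Otimes>\<^sub>M (borel \<Otimes>\<^sub>M borel)) (\<lambda>\<omega>. (x t \<omega>, m t \<omega>, A (t div \<tau>) \<omega>)) D (xi t)"
    and indep_A: "independent_rvs borel (x (k * \<tau>)) borel (A k)"
    and \<beta>: "0 < \<beta>" "\<beta> \<le> 1" and \<delta>: "0 < \<delta>" "\<delta> \<le> 1" and \<eta>: "0 < \<eta>" and L: "0 < L" and \<tau>: "0 < \<tau>"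
begin

lemma gradf_measurable [measurable]: "gradf \<in> borel_measurable borel"
  by (rule lipschitz_borel_measurable) (rule lip)

lemma state_measurable [measurable]:
  "x t \<in> borel_measurable M" "m t \<in> borel_measurable M" "A k \<in> borel_measurable M"
  "xi t \<in> measurable M D"
proof -
  have [measurable]: "(\<lambda>\<omega>. (x t \<omega>, m t \<omega>, A (t div \<tau>) \<omega>)) \<in> measurable M (borel \<Otimes>\<^sub>M (borel \<Otimes>\<^sub>M borel))"
    using indep_xi by (simp add: independent_rvs_def)
  from measurable_compose[OF this measurable_fst] show "x t \<in> borel_measurable M" by simp
  from measurable_compose[OF \<open>_ \<in> measurable M (borel \<Otimes>\<^sub>M (borel \<Otimes>\<^sub>M borel))\<close>
      measurable_compose[OF measurable_snd measurable_fst]]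
  show "m t \<in> borel_measurable M" by simp
  show "A k \<in> borel_measurable M" using indep_A by (simp add: independent_rvs_def)
  show "xi t \<in> measurable M D" using indep_xi by (simp add: independent_rvs_def)
qed

lemma gF_state_measurable [measurable]: "(\<lambda>\<omega>. gF (x t \<omega>) (xi t \<omega>)) \<in> borel_measurable M"
  using measurable_compose[OF measurable_Pair[OF state_measurable(1,4)] gF_measurable] by simp

text \<open>Obtained before any integrability of the iterates: with \<open>x t\<close> frozen, the
  variance bound \<open>v\<close> holds at every point.\<close>

lemma noise_square_integrable: "square_integrable M (\<lambda>\<omega>. gF (x t \<omega>) (xi t \<omega>) - gradf (x t \<omega>))"
proof -
  let ?\<phi> = "\<lambda>(h :: (real ^ 'k) \<times> (real ^ 'k) \<times> (real ^ 'k ^ 'k)) y. ennreal ((norm (gF (fst h) y - gradf (fst h)))\<^sup>2)"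
  have [measurable]: "(\<lambda>(h :: (real ^ 'k) \<times> (real ^ 'k) \<times> (real ^ 'k ^ 'k), y). gF (fst h) y)
      \<in> borel_measurable ((borel \<Otimes>\<^sub>M (borel \<Otimes>\<^sub>M borel)) \<Otimes>\<^sub>M D)"
    using gF_measurable by measurable
  have "(\<integral>\<^sup>+\<omega>. ennreal ((norm (gF (x t \<omega>) (xi t \<omega>) - gradf (x t \<omega>)))\<^sup>2) \<partial>M)
      = (\<integral>\<^sup>+\<omega>. \<integral>\<^sup>+y. ennreal ((norm (gF (x t \<omega>) y - gradf (x t \<omega>)))\<^sup>2) \<partial>D \<partial>M)"
    using independent_rvs_nn_integral[OF indep_xi, of ?\<phi> t] by (simp add: xi_distr)
  also have "\<dots> \<le> (\<integral>\<^sup>+\<omega>. ennreal v \<partial>M)" by (intro nn_integral_mono gF_var)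
  also have "\<dots> < \<infinity>" by (simp add: emeasure_space_1)
  finally show ?thesis
    unfolding square_integrable_def by (auto intro!: integrableI_bounded)
qed

text \<open>The gradient is only Lipschitz, not bounded, so second moments have to be propagated
  along the recursion, with the oracle split into noise and gradient.\<close>

lemma state_square_integrable: "square_integrable M (x t) \<and> square_integrable M (m t)"
proof (induction t)
  case 0
  have "x 0 = (\<lambda>_. x0)" "m 0 = (\<lambda>_. 0)" using x_0 m_0 by auto
  then show ?case by (simp add: square_integrable_def)
next
  case (Suc t)
  have "square_integrable M (\<lambda>\<omega>. (gF (x t \<omega>) (xi t \<omega>) - gradf (x t \<omega>)) + gradf (x t \<omega>))"
    using Suc finite_measure_axioms
    by (intro square_integrable_add noise_square_integrable square_integrable_lipschitz[OF _ _ lip]) auto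
  then have "square_integrable M (\<lambda>\<omega>. gF (x t \<omega>) (xi t \<omega>))" by simp
  then have "square_integrable M (\<lambda>\<omega>. A (t div \<tau>) \<omega> *v ((1 - \<beta>) *\<^sub>R m t \<omega> + \<beta> *\<^sub>R gF (x t \<omega>) (xi t \<omega>)))"
    using Suc proj by (intro square_integrable_projection square_integrable_add square_integrable_scaleR) auto
  then have m: "square_integrable M (m (Suc t))" by (simp add: m_Suc[abs_def])
  have "square_integrable M (\<lambda>\<omega>. x t \<omega> - \<eta> *\<^sub>R m (Suc t) \<omega>)"
    using Suc m by (intro square_integrable_diff square_integrable_scaleR) auto
  then show ?case using m by (simp add: x_Suc[abs_def])
qed

lemma square_integrable_intros:
  "square_integrable M (x t)" "square_integrable M (m t)" "square_integrable M (\<lambda>\<omega>. gradf (x t \<omega>))"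
  "square_integrable M X \<Longrightarrow> square_integrable M (\<lambda>\<omega>. A k \<omega> *v X \<omega>)"
  using state_square_integrable square_integrable_projection[OF _ _ proj]
    square_integrable_lipschitz[OF finite_measure_axioms _ lip] by auto

lemmas square_integrable_rules = square_integrable_intros square_integrable_add
  square_integrable_diff square_integrable_scaleR

lemmas integrable_norm_sq = square_integrable_rules[THEN square_integrable_norm_sq]

section \<open>Recursions for the expected errors\<close>

definition grad_sq where "grad_sq t = expectation (\<lambda>\<omega>. (norm (gradf (x t \<omega>)))\<^sup>2)"
definition momentum_sq where "momentum_sq t = expectation (\<lambda>\<omega>. (norm (m (Suc t) \<omega>))\<^sup>2)"
definition inner_error where
  "inner_error t = expectation (\<lambda>\<omega>. (norm (m (Suc t) \<omega> - A (t div \<tau>) \<omega> *v gradf (x t \<omega>)))\<^sup>2)"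
definition outer_error where
  "outer_error t = expectation (\<lambda>\<omega>. (norm (gradf (x t \<omega>) - A (t div \<tau>) \<omega> *v gradf (x t \<omega>)))\<^sup>2)"
definition drift_sq where
  "drift_sq t = expectation (\<lambda>\<omega>. (norm (gradf (x t \<omega>) - gradf (x (t div \<tau> * \<tau>) \<omega>)))\<^sup>2)"

text \<open>With state and projection frozen, the new sample enters only through its centred noise,
  which adds at most \<open>\<beta>\<^sup>2 * v\<close> and no cross term. The rest of the update,
  minus the projected gradient, is \<open>1 - \<beta>\<close> times
  \<open>A *v (m - g)\<close>.\<close>

lemma inner_error_le:
  "inner_error t \<le> expectation (\<lambda>\<omega>. (1 - \<beta>)\<^sup>2 * (norm (A (t div \<tau>) \<omega> *v (m t \<omega> - gradf (x t \<omega>))))\<^sup>2) + \<beta>\<^sup>2 * v"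
proof -
  let ?\<phi> = "\<lambda>(h :: (real ^ 'k) \<times> (real ^ 'k) \<times> (real ^ 'k ^ 'k)) y.
    ennreal ((norm (snd (snd h) *v ((1 - \<beta>) *\<^sub>R fst (snd h) + \<beta> *\<^sub>R gF (fst h) y) - snd (snd h) *v gradf (fst h)))\<^sup>2)"
  have [measurable]: "(\<lambda>p :: ((real ^ 'k) \<times> (real ^ 'k) \<times> (real ^ 'k ^ 'k)) \<times> 'xi. gF (fst (fst p)) (snd p))
      \<in> borel_measurable ((borel \<Otimes>\<^sub>M (borel \<Otimes>\<^sub>M borel)) \<Otimes>\<^sub>M D)"
    using gF_measurable by measurable
  have \<phi>: "(\<lambda>(h, y). ?\<phi> h y) \<in> borel_measurable ((borel \<Otimes>\<^sub>M (borel \<Otimes>\<^sub>M borel)) \<Otimes>\<^sub>M D)"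
    unfolding case_prod_beta by measurable
  have int: "integrable M (\<lambda>\<omega>. (1 - \<beta>)\<^sup>2 * (norm (A (t div \<tau>) \<omega> *v (m t \<omega> - gradf (x t \<omega>))))\<^sup>2)"
    by (intro integrable_mult_right integrable_norm_sq square_integrable_rules)
  have "ennreal (inner_error t) = (\<integral>\<^sup>+\<omega>. ennreal ((norm (m (Suc t) \<omega> - A (t div \<tau>) \<omega> *v gradf (x t \<omega>)))\<^sup>2) \<partial>M)"
    unfolding inner_error_def
    by (intro nn_integral_eq_integral[symmetric] integrable_norm_sq square_integrable_rules) auto
  also have "\<dots> = (\<integral>\<^sup>+\<omega>. \<integral>\<^sup>+y. ennreal ((norm (A (t div \<tau>) \<omega> *v ((1 - \<beta>) *\<^sub>R m t \<omega> + \<beta> *\<^sub>R gF (x t \<omega>) y)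
        - A (t div \<tau>) \<omega> *v gradf (x t \<omega>)))\<^sup>2) \<partial>D \<partial>M)"
    using independent_rvs_nn_integral[OF indep_xi \<phi>] by (simp add: xi_distr m_Suc)
  also have "\<dots> \<le> (\<integral>\<^sup>+\<omega>. ennreal ((1 - \<beta>)\<^sup>2 * (norm (A (t div \<tau>) \<omega> *v (m t \<omega> - gradf (x t \<omega>))))\<^sup>2 + \<beta>\<^sup>2 * v) \<partial>M)"
    using proj[of "t div \<tau>"]
  proof (intro nn_integral_mono_AE, eventually_elim)
    fix \<omega> assume A: "orthogonal_projection (A (t div \<tau>) \<omega>)"
    let ?A = "A (t div \<tau>) \<omega>" and ?z = "x t \<omega>"
    have "?A *v ((1 - \<beta>) *\<^sub>R m t \<omega> + \<beta> *\<^sub>R gF ?z y) - ?A *v gradf ?z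
        = (1 - \<beta>) *\<^sub>R (?A *v (m t \<omega> - gradf ?z)) + \<beta> *\<^sub>R (?A *v (gF ?z y - gradf ?z))" for y
      by (simp add: matrix_vector_right_distrib matrix_vector_mult_diff_distrib matrix_vector_mult_scaleR algebra_simps)
    moreover have "(\<integral>\<^sup>+y. ennreal ((norm ((1 - \<beta>) *\<^sub>R (?A *v (m t \<omega> - gradf ?z)) + \<beta> *\<^sub>R (?A *v (gF ?z y - gradf ?z))))\<^sup>2) \<partial>D)
        \<le> ennreal ((norm ((1 - \<beta>) *\<^sub>R (?A *v (m t \<omega> - gradf ?z))))\<^sup>2 + \<beta>\<^sup>2 * v)"
      using gF_mean[of ?z] prob_space.prob_space[OF D] D
      by (intro centered_noise_norm_sq_le D A gF_var v) (auto simp: prob_space.finite_measure finite_measure.integrable_const)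
    ultimately show "(\<integral>\<^sup>+y. ennreal ((norm (?A *v ((1 - \<beta>) *\<^sub>R m t \<omega> + \<beta> *\<^sub>R gF ?z y) - ?A *v gradf ?z))\<^sup>2) \<partial>D)
        \<le> ennreal ((1 - \<beta>)\<^sup>2 * (norm (?A *v (m t \<omega> - gradf ?z)))\<^sup>2 + \<beta>\<^sup>2 * v)"
      by (simp add: power_mult_distrib)
  qed
  also have "\<dots> = ennreal (expectation (\<lambda>\<omega>. (1 - \<beta>)\<^sup>2 * (norm (A (t div \<tau>) \<omega> *v (m t \<omega> - gradf (x t \<omega>))))\<^sup>2) + \<beta>\<^sup>2 * v)"
    using int v by (subst nn_integral_eq_integral) (auto simp: prob_space)
  finally show ?thesis
    using v by (subst (asm) ennreal_le_iff) (auto intro!: add_nonneg_nonneg integral_nonneg_AE)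
qed

lemma inner_error_0: "inner_error 0 \<le> grad_sq 0 + \<beta>\<^sup>2 * v"
proof -
  have "expectation (\<lambda>\<omega>. (1 - \<beta>)\<^sup>2 * (norm (A (0 div \<tau>) \<omega> *v (m 0 \<omega> - gradf (x 0 \<omega>))))\<^sup>2) \<le> grad_sq 0"
    unfolding grad_sq_def
  proof (intro integral_mono_AE integrable_mult_right integrable_norm_sq square_integrable_rules)
    show "AE \<omega> in M. (1 - \<beta>)\<^sup>2 * (norm (A (0 div \<tau>) \<omega> *v (m 0 \<omega> - gradf (x 0 \<omega>))))\<^sup>2 \<le> (norm (gradf (x 0 \<omega>)))\<^sup>2"
      using proj[of "0 div \<tau>"]
    proof eventually_elim
      case (elim \<omega>)
      have "(1 - \<beta>)\<^sup>2 * (norm (A (0 div \<tau>) \<omega> *v (m 0 \<omega> - gradf (x 0 \<omega>))))\<^sup>2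
          \<le> 1 * (norm (m 0 \<omega> - gradf (x 0 \<omega>)))\<^sup>2"
        using \<beta> by (intro mult_mono power_le_one power_mono orthogonal_projection_norm_le elim) auto
      then show ?case by (simp add: m_0)
    qed
  qed
  then show ?thesis using inner_error_le[of 0] by linarith
qed

lemma gradf_diff_sq: "(norm (gradf y - gradf z))\<^sup>2 \<le> L\<^sup>2 * (norm (y - z))\<^sup>2"
  using power_mono[OF lip[of y z], of 2] by (simp add: power_mult_distrib)

lemma momentum_in_range:
  "orthogonal_projection (A (t div \<tau>) \<omega>) \<Longrightarrow> A (t div \<tau>) \<omega> *v m (Suc t) \<omega> = m (Suc t) \<omega>"
  by (simp add: m_Suc orthogonal_projection_idem)

lemma inner_error_Suc:
  "inner_error (Suc t) \<le> (1 - \<beta>) * inner_error t + 1 / \<beta> * (L\<^sup>2 * \<eta>\<^sup>2 * momentum_sq t)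
    + (if \<tau> dvd Suc t then grad_sq (Suc t) else 0) + \<beta>\<^sup>2 * v"
proof -
  let ?s = "if \<tau> dvd Suc t then 1 else 0 :: real"
  have "expectation (\<lambda>\<omega>. (1 - \<beta>)\<^sup>2 * (norm (A (Suc t div \<tau>) \<omega> *v (m (Suc t) \<omega> - gradf (x (Suc t) \<omega>))))\<^sup>2)
    \<le> expectation (\<lambda>\<omega>. (1 - \<beta>) * (norm (m (Suc t) \<omega> - A (t div \<tau>) \<omega> *v gradf (x t \<omega>)))\<^sup>2
        + 1 / \<beta> * (L\<^sup>2 * \<eta>\<^sup>2 * (norm (m (Suc t) \<omega>))\<^sup>2) + ?s * (norm (gradf (x (Suc t) \<omega>)))\<^sup>2)"
  proof (intro integral_mono_AE Bochner_Integration.integrable_add integrable_mult_right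
      integrable_norm_sq square_integrable_rules)
    show "AE \<omega> in M. (1 - \<beta>)\<^sup>2 * (norm (A (Suc t div \<tau>) \<omega> *v (m (Suc t) \<omega> - gradf (x (Suc t) \<omega>))))\<^sup>2
        \<le> (1 - \<beta>) * (norm (m (Suc t) \<omega> - A (t div \<tau>) \<omega> *v gradf (x t \<omega>)))\<^sup>2
          + 1 / \<beta> * (L\<^sup>2 * \<eta>\<^sup>2 * (norm (m (Suc t) \<omega>))\<^sup>2) + ?s * (norm (gradf (x (Suc t) \<omega>)))\<^sup>2"
      using proj[of "Suc t div \<tau>"] proj[of "t div \<tau>"]
    proof eventually_elim
      case (elim \<omega>)
      \<comment> \<open>The quotient changes only at multiples of \<open>\<tau>\<close>, so the
        extra gradient is charged at resampling times alone.\<close>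
      have "A (Suc t div \<tau>) \<omega> = A (t div \<tau>) \<omega>" if "\<not> \<tau> dvd Suc t"
        using that by (simp add: div_Suc dvd_eq_mod_eq_0)
      note P = projected_momentum_error_le[OF elim momentum_in_range[OF elim(2)] \<beta> this,
          where switch = "\<tau> dvd Suc t" and g = "gradf (x (Suc t) \<omega>)" and g' = "gradf (x t \<omega>)"]
      have "(norm (gradf (x (Suc t) \<omega>) - gradf (x t \<omega>)))\<^sup>2 \<le> L\<^sup>2 * \<eta>\<^sup>2 * (norm (m (Suc t) \<omega>))\<^sup>2"
        using gradf_diff_sq[of "x (Suc t) \<omega>" "x t \<omega>"] by (simp add: x_Suc power_mult_distrib)
      then have "1 / \<beta> * (norm (gradf (x (Suc t) \<omega>) - gradf (x t \<omega>)))\<^sup>2 \<le> 1 / \<beta> * (L\<^sup>2 * \<eta>\<^sup>2 * (norm (m (Suc t) \<omega>))\<^sup>2)"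
        using \<beta> by (intro mult_left_mono) auto
      then show ?case using P by (cases "\<tau> dvd Suc t") simp_all
    qed
  qed
  also have "\<dots> = (1 - \<beta>) * inner_error t + 1 / \<beta> * (L\<^sup>2 * \<eta>\<^sup>2 * momentum_sq t) + ?s * grad_sq (Suc t)"
  proof -
    have i1: "integrable M (\<lambda>\<omega>. (norm (m (Suc t) \<omega> - A (t div \<tau>) \<omega> *v gradf (x t \<omega>)))\<^sup>2)"
      by (intro integrable_norm_sq square_integrable_rules)
    have i2: "integrable M (\<lambda>\<omega>. (norm (m (Suc t) \<omega>))\<^sup>2)"
      by (intro integrable_norm_sq square_integrable_rules)
    have i3: "integrable M (\<lambda>\<omega>. (norm (gradf (x (Suc t) \<omega>)))\<^sup>2)"
      by (intro integrable_norm_sq square_integrable_rules)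
    have "expectation (\<lambda>\<omega>. a * X \<omega> + b * (c * Y \<omega>) + e * Z \<omega>)
        = a * expectation X + b * (c * expectation Y) + e * expectation Z"
      if "integrable M X" "integrable M Y" "integrable M Z" for a b c e :: real and X Y Z
      using that by simp
    from this[OF i1 i2 i3] show ?thesis
      unfolding inner_error_def momentum_sq_def grad_sq_def .
  qed
  finally show ?thesis using inner_error_le[of "Suc t"] by (cases "\<tau> dvd Suc t") simp_all
qed

text \<open>Here the iterate is frozen and the fresh projection is averaged, so
  \<open>proj_mean\<close> applies to a deterministic vector.\<close>

lemma resampled_residual:
  "expectation (\<lambda>\<omega>. (norm (gradf (x (k * \<tau>) \<omega>) - A k \<omega> *v gradf (x (k * \<tau>) \<omega>)))\<^sup>2) \<le> (1 - \<delta>) * grad_sq (k * \<tau>)"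
proof -
  have "ennreal (expectation (\<lambda>\<omega>. (norm (gradf (x (k * \<tau>) \<omega>) - A k \<omega> *v gradf (x (k * \<tau>) \<omega>)))\<^sup>2))
      = (\<integral>\<^sup>+\<omega>. ennreal ((norm (gradf (x (k * \<tau>) \<omega>) - A k \<omega> *v gradf (x (k * \<tau>) \<omega>)))\<^sup>2) \<partial>M)"
    by (intro nn_integral_eq_integral[symmetric] integrable_norm_sq square_integrable_rules) auto
  also have "\<dots> = (\<integral>\<^sup>+\<omega>. \<integral>\<^sup>+B. ennreal ((norm (gradf (x (k * \<tau>) \<omega>) - B *v gradf (x (k * \<tau>) \<omega>)))\<^sup>2) \<partial>distr M borel (A k) \<partial>M)"
    by (rule independent_rvs_nn_integral[OF indep_A]) measurable
  also have "\<dots> = (\<integral>\<^sup>+\<omega>. \<integral>\<^sup>+\<omega>'. ennreal ((norm (gradf (x (k * \<tau>) \<omega>) - A k \<omega>' *v gradf (x (k * \<tau>) \<omega>)))\<^sup>2) \<partial>M \<partial>M)"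
    by (subst nn_integral_distr) auto
  also have "\<dots> \<le> (\<integral>\<^sup>+\<omega>. ennreal ((1 - \<delta>) * (norm (gradf (x (k * \<tau>) \<omega>)))\<^sup>2) \<partial>M)"
    by (intro nn_integral_mono proj_mean)
  also have "\<dots> = ennreal ((1 - \<delta>) * grad_sq (k * \<tau>))"
    unfolding grad_sq_def using \<delta>
    by (subst nn_integral_eq_integral) (auto intro!: integrable_norm_sq square_integrable_rules)
  finally show ?thesis
    using \<delta> by (subst (asm) ennreal_le_iff) (auto simp: grad_sq_def)
qed

text \<open>The detour goes through the gradient at the period start, where the mean of the residual
  is controlled. The complement of a projection is linear and nonexpansive, so the residual of the
  drift is at most the drift.\<close>

lemma outer_error_le:
  "outer_error t \<le> (1 + \<delta> / 4) * ((1 - \<delta>) * grad_sq (t div \<tau> * \<tau>)) + (1 + 1 / (\<delta> / 4)) * drift_sq t"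
proof -
  let ?k = "t div \<tau>"
  let ?gs = "\<lambda>\<omega>. gradf (x (?k * \<tau>) \<omega>)" and ?g = "\<lambda>\<omega>. gradf (x t \<omega>)"
  have "outer_error t \<le> expectation (\<lambda>\<omega>. (1 + \<delta> / 4) * (norm (?gs \<omega> - A ?k \<omega> *v ?gs \<omega>))\<^sup>2
      + (1 + 1 / (\<delta> / 4)) * (norm (?g \<omega> - ?gs \<omega>))\<^sup>2)"
    unfolding outer_error_def
  proof (intro integral_mono_AE Bochner_Integration.integrable_add integrable_mult_right
      integrable_norm_sq square_integrable_rules)
    show "AE \<omega> in M. (norm (?g \<omega> - A ?k \<omega> *v ?g \<omega>))\<^sup>2 \<le> (1 + \<delta> / 4) * (norm (?gs \<omega> - A ?k \<omega> *v ?gs \<omega>))\<^sup>2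
      + (1 + 1 / (\<delta> / 4)) * (norm (?g \<omega> - ?gs \<omega>))\<^sup>2"
      using proj[of ?k]
    proof eventually_elim
      case (elim \<omega>)
      let ?u = "?gs \<omega> - A ?k \<omega> *v ?gs \<omega>" and ?w = "?g \<omega> - ?gs \<omega>"
      have "?g \<omega> - A ?k \<omega> *v ?g \<omega> = ?u + (?w - A ?k \<omega> *v ?w)"
        by (simp add: matrix_vector_mult_diff_distrib)
      then have "(norm (?g \<omega> - A ?k \<omega> *v ?g \<omega>))\<^sup>2
          \<le> (1 + \<delta> / 4) * (norm ?u)\<^sup>2 + (1 + 1 / (\<delta> / 4)) * (norm (?w - A ?k \<omega> *v ?w))\<^sup>2"
        using norm_add_sq_le[of "\<delta> / 4"] \<delta> by (metis divide_pos_pos zero_less_numeral)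
      also have "\<dots> \<le> (1 + \<delta> / 4) * (norm ?u)\<^sup>2 + (1 + 1 / (\<delta> / 4)) * (norm ?w)\<^sup>2"
        using \<delta> by (intro add_left_mono mult_left_mono power_mono orthogonal_projection_residual_le elim) auto
      finally show ?case .
    qed
  qed
  also have "\<dots> = (1 + \<delta> / 4) * expectation (\<lambda>\<omega>. (norm (?gs \<omega> - A ?k \<omega> *v ?gs \<omega>))\<^sup>2) + (1 + 1 / (\<delta> / 4)) * drift_sq t"
    unfolding drift_sq_def
    by (subst Bochner_Integration.integral_add) (auto intro!: integrable_norm_sq square_integrable_rules)
  also have "\<dots> \<le> (1 + \<delta> / 4) * ((1 - \<delta>) * grad_sq (?k * \<tau>)) + (1 + 1 / (\<delta> / 4)) * drift_sq t"
    using \<delta> by (intro add_right_mono mult_left_mono resampled_residual) auto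
  finally show ?thesis .
qed

lemma grad_sq_period_start_le:
  assumes "0 < c"
  shows "grad_sq (t div \<tau> * \<tau>) \<le> (1 + c) * grad_sq t + (1 + 1 / c) * drift_sq t"
proof -
  let ?gs = "\<lambda>\<omega>. gradf (x (t div \<tau> * \<tau>) \<omega>)" and ?g = "\<lambda>\<omega>. gradf (x t \<omega>)"
  have "grad_sq (t div \<tau> * \<tau>) \<le> expectation (\<lambda>\<omega>. (1 + c) * (norm (?g \<omega>))\<^sup>2 + (1 + 1 / c) * (norm (?g \<omega> - ?gs \<omega>))\<^sup>2)"
    unfolding grad_sq_def
  proof (intro integral_mono Bochner_Integration.integrable_add integrable_mult_right
      integrable_norm_sq square_integrable_rules)
    fix \<omega>
    show "(norm (?gs \<omega>))\<^sup>2 \<le> (1 + c) * (norm (?g \<omega>))\<^sup>2 + (1 + 1 / c) * (norm (?g \<omega> - ?gs \<omega>))\<^sup>2"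
      using norm_add_sq_le[OF assms, of "?g \<omega>" "?gs \<omega> - ?g \<omega>"] by (simp add: norm_minus_commute)
  qed
  also have "\<dots> = (1 + c) * grad_sq t + (1 + 1 / c) * drift_sq t"
    unfolding drift_sq_def grad_sq_def
    by (subst Bochner_Integration.integral_add) (auto intro!: integrable_norm_sq square_integrable_rules)
  finally show ?thesis .
qed

lemma drift_sq_le_momentum:
  "drift_sq t \<le> L\<^sup>2 * (real \<tau> * (\<eta>\<^sup>2 * (\<Sum>j\<in>{t div \<tau> * \<tau>..<t}. momentum_sq j)))"
proof -
  let ?s = "t div \<tau> * \<tau>"
  have "drift_sq t \<le> expectation (\<lambda>\<omega>. L\<^sup>2 * (real \<tau> * (\<eta>\<^sup>2 * (\<Sum>j\<in>{?s..<t}. (norm (m (Suc j) \<omega>))\<^sup>2))))"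
    unfolding drift_sq_def
  proof (intro integral_mono integrable_mult_right Bochner_Integration.integrable_sum
      integrable_norm_sq square_integrable_rules)
    fix \<omega>
    have "real (t - ?s) \<le> real \<tau>" using \<tau> by (simp add: minus_div_mult_eq_mod less_imp_le)
    then have "real (t - ?s) * (\<eta>\<^sup>2 * (\<Sum>j\<in>{?s..<t}. (norm (m (Suc j) \<omega>))\<^sup>2))
        \<le> real \<tau> * (\<eta>\<^sup>2 * (\<Sum>j\<in>{?s..<t}. (norm (m (Suc j) \<omega>))\<^sup>2))"
      by (intro mult_right_mono mult_nonneg_nonneg sum_nonneg) auto
    then have "(norm (x t \<omega> - x ?s \<omega>))\<^sup>2 \<le> real \<tau> * (\<eta>\<^sup>2 * (\<Sum>j\<in>{?s..<t}. (norm (m (Suc j) \<omega>))\<^sup>2))"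
      using drift_sq_le[of "\<lambda>t. x t \<omega>" \<eta> "\<lambda>t. m t \<omega>" ?s t] x_Suc by force
    then have "L\<^sup>2 * (norm (x t \<omega> - x ?s \<omega>))\<^sup>2 \<le> L\<^sup>2 * (real \<tau> * (\<eta>\<^sup>2 * (\<Sum>j\<in>{?s..<t}. (norm (m (Suc j) \<omega>))\<^sup>2)))"
      by (intro mult_left_mono) auto
    then show "(norm (gradf (x t \<omega>) - gradf (x ?s \<omega>)))\<^sup>2
        \<le> L\<^sup>2 * (real \<tau> * (\<eta>\<^sup>2 * (\<Sum>j\<in>{?s..<t}. (norm (m (Suc j) \<omega>))\<^sup>2)))"
      using gradf_diff_sq order_trans by blast
  qed
  also have "\<dots> = L\<^sup>2 * (real \<tau> * (\<eta>\<^sup>2 * (\<Sum>j\<in>{?s..<t}. momentum_sq j)))"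
    unfolding momentum_sq_def
    by (simp add: Bochner_Integration.integral_sum integrable_norm_sq square_integrable_rules)
  finally show ?thesis .
qed

lemma expected_descent:
  assumes deriv: "\<And>x. (f has_derivative (\<lambda>h. gradf x \<bullet> h)) (at x)"
    and bdd: "bdd_below (range f)" and \<eta>L: "\<eta> * L \<le> 1 / 4"
  shows "(\<Sum>t<T. grad_sq t) + 3 / 4 * (\<Sum>t<T. momentum_sq t)
    \<le> 2 * (f x0 - Inf (range f)) / \<eta> + (\<Sum>t<T. inner_error t + outer_error t)"
proof -
  let ?e = "\<lambda>t \<omega>. (norm (m (Suc t) \<omega> - A (t div \<tau>) \<omega> *v gradf (x t \<omega>)))\<^sup>2
      + (norm (gradf (x t \<omega>) - A (t div \<tau>) \<omega> *v gradf (x t \<omega>)))\<^sup>2"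
  have "(\<Sum>t<T. grad_sq t) + 3 / 4 * (\<Sum>t<T. momentum_sq t)
      = expectation (\<lambda>\<omega>. (\<Sum>t<T. (norm (gradf (x t \<omega>)))\<^sup>2) + 3 / 4 * (\<Sum>t<T. (norm (m (Suc t) \<omega>))\<^sup>2))"
  proof -
    have i1: "integrable M (\<lambda>\<omega>. (norm (gradf (x t \<omega>)))\<^sup>2)" for t
      by (intro integrable_norm_sq square_integrable_rules)
    have i2: "integrable M (\<lambda>\<omega>. (norm (m (Suc t) \<omega>))\<^sup>2)" for t
      by (intro integrable_norm_sq square_integrable_rules)
    from i1 i2 show ?thesis
      unfolding grad_sq_def momentum_sq_def
      by (simp add: Bochner_Integration.integral_add Bochner_Integration.integral_sum
          del: integral_mult_right_zero times_divide_eq_left)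
  qed
  also have "\<dots> \<le> expectation (\<lambda>\<omega>. 2 * (f x0 - Inf (range f)) / \<eta> + (\<Sum>t<T. ?e t \<omega>))"
  proof (intro integral_mono_AE Bochner_Integration.integrable_add integrable_mult_right
      Bochner_Integration.integrable_sum integrable_norm_sq square_integrable_rules integrable_const)
    have "AE \<omega> in M. \<forall>k. orthogonal_projection (A k \<omega>)" using proj by (simp add: AE_all_countable)
    then show "AE \<omega> in M. (\<Sum>t<T. (norm (gradf (x t \<omega>)))\<^sup>2) + 3 / 4 * (\<Sum>t<T. (norm (m (Suc t) \<omega>))\<^sup>2)
        \<le> 2 * (f x0 - Inf (range f)) / \<eta> + (\<Sum>t<T. ?e t \<omega>)"
    proof eventually_elim
      case (elim \<omega>)
      have "(norm (m (Suc t) \<omega> - gradf (x t \<omega>)))\<^sup>2 = ?e t \<omega>" for t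
        using elim by (intro orthogonal_projection_pythagoras momentum_in_range) auto
      then show ?case
        using momentum_descent_sum[OF deriv lip bdd, of "\<lambda>t. x t \<omega>" \<eta> "\<lambda>t. m t \<omega>" T] x_Suc \<eta> \<eta>L
        by (simp add: x_0)
    qed
  qed
  also have "\<dots> = 2 * (f x0 - Inf (range f)) / \<eta> + (\<Sum>t<T. inner_error t + outer_error t)"
  proof -
    have e: "integrable M (?e t)" "expectation (?e t) = inner_error t + outer_error t" for t
      unfolding inner_error_def outer_error_def
      by (auto intro!: integrable_norm_sq square_integrable_rules Bochner_Integration.integral_add)
    then have "integrable M (\<lambda>\<omega>. \<Sum>t<T. ?e t \<omega>)" by (intro Bochner_Integration.integrable_sum)
    then have "expectation (\<lambda>\<omega>. 2 * (f x0 - Inf (range f)) / \<eta> + (\<Sum>t<T. ?e t \<omega>))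
        = 2 * (f x0 - Inf (range f)) / \<eta> + expectation (\<lambda>\<omega>. \<Sum>t<T. ?e t \<omega>)"
      by (subst Bochner_Integration.integral_add) (auto simp: prob_space)
    also have "expectation (\<lambda>\<omega>. \<Sum>t<T. ?e t \<omega>) = (\<Sum>t<T. inner_error t + outer_error t)"
      by (subst Bochner_Integration.integral_sum) (auto simp only: e)
    finally show ?thesis .
  qed
  finally show ?thesis .
qed

lemma gradient_sum_bound:
  assumes deriv: "\<And>x. (f has_derivative (\<lambda>h. gradf x \<bullet> h)) (at x)"
    and bdd: "bdd_below (range f)" and \<eta>L: "\<eta> * L \<le> 1 / 4"
    and \<tau>_large: "64 / (3 * \<beta> * \<delta>) \<le> real \<tau>"
    and \<eta>_small: "L\<^sup>2 * \<eta>\<^sup>2 \<le> 3 * \<delta> * \<beta>\<^sup>2 / 80" "L\<^sup>2 * \<eta>\<^sup>2 * (real \<tau>)\<^sup>2 \<le> 3 * \<delta> / 80"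
  shows "(\<Sum>t<K * \<tau>. \<integral>\<^sup>+\<omega>. ennreal ((norm (gradf (x t \<omega>)))\<^sup>2) \<partial>M)
    \<le> ennreal (16 * (f x0 - Inf (range f)) / (\<delta> * \<eta>) + real (K * \<tau>) * (32 * \<beta> * v / (3 * \<delta>)))"
proof -
  have "0 \<le> f x0 - Inf (range f)" using cInf_lower[OF _ bdd, of "f x0"] by simp
  then have "(\<Sum>t<K * \<tau>. grad_sq t)
      \<le> 16 * (f x0 - Inf (range f)) / (\<delta> * \<eta>) + real (K * \<tau>) * (32 * \<beta> * v / (3 * \<delta>))"
    by (intro subspace_momentum_rate[of grad_sq momentum_sq inner_error drift_sq])
      (use \<beta> \<delta> \<eta> v \<tau>_large \<eta>_small inner_error_0 inner_error_Suc outer_error_le grad_sq_period_start_le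
        drift_sq_le_momentum expected_descent[OF deriv bdd \<eta>L] in
        \<open>simp_all add: grad_sq_def momentum_sq_def inner_error_def drift_sq_def\<close>)
  moreover have "(\<integral>\<^sup>+\<omega>. ennreal ((norm (gradf (x t \<omega>)))\<^sup>2) \<partial>M) = ennreal (grad_sq t)" for t
    unfolding grad_sq_def by (intro nn_integral_eq_integral integrable_norm_sq square_integrable_rules) auto
  moreover have "0 \<le> grad_sq t" for t by (simp add: grad_sq_def)
  ultimately show ?thesis by (simp add: sum_ennreal ennreal_leI)
qed

end

section \<open>Haar projections and the layer structure\<close>

definition gram :: "nat \<Rightarrow> mat \<Rightarrow> mat" where
  "gram r P = mmul r P (mtr P)"

lemma gram_nth: "gram r P i j = (\<Sum>c<r. P i c * P j c)"
  by (simp add: gram_def mmul_def mtr_def)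

lemma gram_sym: "gram r P i j = gram r P j i"
  by (simp add: gram_nth mult.commute)

lemma gram_idem:
  assumes "P \<in> stiefel p r"
  shows "(\<Sum>k<p. gram r P i k * gram r P k j) = gram r P i j"
proof -
  have "(\<Sum>k<p. gram r P i k * gram r P k j) = (\<Sum>k<p. \<Sum>c<r. \<Sum>d<r. P i c * P j d * (P k c * P k d))"
    by (simp add: gram_nth sum_product mult_ac)
  also have "\<dots> = (\<Sum>c<r. \<Sum>k<p. \<Sum>d<r. P i c * P j d * (P k c * P k d))"
    by (rule sum.swap)
  also have "\<dots> = (\<Sum>c<r. \<Sum>d<r. \<Sum>k<p. P i c * P j d * (P k c * P k d))"
    by (intro sum.cong refl sum.swap)
  also have "\<dots> = (\<Sum>c<r. \<Sum>d<r. P i c * P j d * (\<Sum>k<p. P k c * P k d))"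
    by (simp add: sum_distrib_left)
  also have "\<dots> = (\<Sum>c<r. \<Sum>d<r. P i c * P j d * (if c = d then 1 else 0))"
    using assms by (intro sum.cong refl) (auto simp: stiefel_def)
  also have "\<dots> = gram r P i j" by (simp add: gram_nth if_distrib[of "\<lambda>x. _ * x"] cong: if_cong)
  finally show ?thesis .
qed

lemma stiefel_column_norm: "P \<in> stiefel p r \<Longrightarrow> c < r \<Longrightarrow> (\<Sum>k<p. (P k c)\<^sup>2) = 1"
  by (auto simp: stiefel_def power2_eq_square)

lemma stiefel_entry_bound:
  assumes "P \<in> stiefel p r" "i < p" "c < r"
  shows "\<bar>P i c\<bar> \<le> 1"
proof -
  have "(P i c)\<^sup>2 \<le> (\<Sum>k<p. (P k c)\<^sup>2)" using assms by (intro member_le_sum) auto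
  then show ?thesis using stiefel_column_norm[OF assms(1,3)] by (simp add: abs_square_le_1)
qed

lemma mat_M_entry_measurable [measurable]: "(\<lambda>P. P i j) \<in> borel_measurable mat_M"
proof -
  have "(\<lambda>P :: mat. P i) \<in> measurable mat_M (Pi\<^sub>M UNIV (\<lambda>_. borel))"
    unfolding mat_M_def by (rule measurable_component_singleton) simp
  then show ?thesis
    by (rule measurable_compose) (rule measurable_component_singleton, simp)
qed

lemma gram_measurable [measurable]: "(\<lambda>P. gram r P i j) \<in> borel_measurable mat_M"
  unfolding gram_nth by measurable

lemma mmul_measurable: "(\<lambda>P. mmul p U P) \<in> measurable mat_M mat_M"
proof -
  have "(\<lambda>P i j. \<Sum>k<p. U i k * P k j) \<in> measurable mat_M (Pi\<^sub>M UNIV (\<lambda>_. Pi\<^sub>M UNIV (\<lambda>_. borel)))"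
    by (intro measurable_PiM_single' ) (auto simp: space_PiM)
  then show ?thesis by (simp add: mmul_def mat_M_def)
qed

text \<open>Reflections of one coordinate and transpositions of two are the only orthogonal matrices
  for which Haar invariance is used: the former kill the off-diagonal means, the latter make the
  diagonal ones equal.\<close>

definition sign_flip :: "nat \<Rightarrow> nat \<Rightarrow> mat" where
  "sign_flip p i = (\<lambda>a b. if a = b \<and> a < p then if a = i then - 1 else 1 else 0)"

definition row_swap :: "nat \<Rightarrow> nat \<Rightarrow> nat \<Rightarrow> mat" where
  "row_swap p i j = (\<lambda>a b. if a < p \<and> b < p \<and> b = Transposition.transpose i j a then 1 else 0)"

lemma sign_flip_stiefel: "sign_flip p i \<in> stiefel p p"
proof -
  have "(\<Sum>k<p. sign_flip p i k a * sign_flip p i k b) = (\<Sum>k<p. if k = a then if a = b then 1 else 0 else 0)" for a b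
    by (intro sum.cong) (auto simp: sign_flip_def)
  then show ?thesis by (auto simp: stiefel_def) (auto simp: sign_flip_def)
qed

lemma sign_flip_mmul: "a < p \<Longrightarrow> mmul p (sign_flip p i) P a c = (if a = i then - P a c else P a c)"
proof -
  assume "a < p"
  then have "mmul p (sign_flip p i) P a c = (\<Sum>k<p. if k = a then if a = i then - P a c else P a c else 0)"
    unfolding mmul_def by (intro sum.cong) (auto simp: sign_flip_def)
  with \<open>a < p\<close> show ?thesis by simp
qed

lemma row_swap_stiefel:
  assumes "i < p" "j < p"
  shows "row_swap p i j \<in> stiefel p p"
proof -
  have t: "Transposition.transpose i j a < p" if "a < p" for a
    using assms that by (auto simp: Transposition.transpose_def)
  have "(\<Sum>k<p. row_swap p i j k a * row_swap p i j k b)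
      = (\<Sum>k<p. if k = Transposition.transpose i j a then if a = b then 1 else 0 else 0)" if "a < p" "b < p" for a b
    using that t by (intro sum.cong) (auto simp: row_swap_def)
  then show ?thesis using t by (auto simp: stiefel_def) (auto simp: row_swap_def)
qed

lemma row_swap_mmul:
  assumes "i < p" "j < p" "a < p"
  shows "mmul p (row_swap p i j) P a c = P (Transposition.transpose i j a) c"
proof -
  have t: "Transposition.transpose i j a < p" using assms by (auto simp: Transposition.transpose_def)
  have "mmul p (row_swap p i j) P a c = (\<Sum>k<p. if k = Transposition.transpose i j a then P (Transposition.transpose i j a) c else 0)"
    unfolding mmul_def using assms by (intro sum.cong) (auto simp: row_swap_def)
  with t show ?thesis by simp
qed

lemma haar_stiefel_AE: "haar_stiefel p r \<mu> \<Longrightarrow> AE P in \<mu>. P \<in> stiefel p r"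
  by (intro prob_space.AE_prob_1) (auto simp: haar_stiefel_def measure_def)

context
  fixes p r :: nat and \<mu> :: "mat measure"
  assumes haar: "haar_stiefel p r \<mu>"
begin

interpretation prob_space \<mu> using haar by (simp add: haar_stiefel_def)

lemma haar_stiefel_measurable: "f \<in> borel_measurable mat_M \<Longrightarrow> f \<in> borel_measurable \<mu>"
  using haar measurable_cong_sets[of \<mu> mat_M] by (auto simp: haar_stiefel_def)

lemma haar_stiefel_integral_mmul:
  fixes f :: "mat \<Rightarrow> real"
  assumes U: "U \<in> stiefel p p" and f: "f \<in> borel_measurable mat_M"
  shows "(\<integral>P. f (mmul p U P) \<partial>\<mu>) = (\<integral>P. f P \<partial>\<mu>)"
proof -
  have "(\<lambda>P. mmul p U P) \<in> measurable \<mu> mat_M"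
    using mmul_measurable haar measurable_cong_sets[of \<mu> mat_M mat_M mat_M] by (auto simp: haar_stiefel_def)
  then have "(\<integral>P. f P \<partial>distr \<mu> mat_M (\<lambda>P. mmul p U P)) = (\<integral>P. f (mmul p U P) \<partial>\<mu>)"
    using f by (rule integral_distr)
  then show ?thesis using haar U by (simp add: haar_stiefel_def)
qed

lemma haar_stiefel_gram_integrable:
  assumes "i < p" "j < p"
  shows "integrable \<mu> (\<lambda>P. gram r P i j)"
proof (rule integrable_const_bound)
  show "AE P in \<mu>. norm (gram r P i j) \<le> real r"
    using haar_stiefel_AE[OF haar]
  proof eventually_elim
    case (elim P)
    have "\<bar>gram r P i j\<bar> \<le> (\<Sum>c<r. \<bar>P i c * P j c\<bar>)" unfolding gram_nth by (rule sum_abs)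
    also have "\<dots> \<le> (\<Sum>c<r. 1)"
      using stiefel_entry_bound[OF elim] assms by (intro sum_mono) (auto simp: abs_mult intro!: mult_le_one)
    finally show ?case by simp
  qed
  show "(\<lambda>P. gram r P i j) \<in> borel_measurable \<mu>" by (intro haar_stiefel_measurable gram_measurable)
qed

text \<open>The common diagonal mean follows from the trace: each of the \<open>r\<close> unit
  columns contributes 1, so \<open>p\<close> equal means add up to \<open>r\<close>. Off the
  diagonal, flipping the sign of row \<open>i\<close> shows the mean to equal its negative.\<close>

lemma haar_stiefel_gram_integral:
  assumes i: "i < p" and j: "j < p"
  shows "(\<integral>P. gram r P i j \<partial>\<mu>) = (if i = j then real r / real p else 0)"
proof (cases "i = j")
  case False
  have "(\<integral>P. gram r P i j \<partial>\<mu>) = (\<integral>P. gram r (mmul p (sign_flip p i) P) i j \<partial>\<mu>)"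
    by (rule haar_stiefel_integral_mmul[OF sign_flip_stiefel gram_measurable, symmetric])
  also have "\<dots> = (\<integral>P. - gram r P i j \<partial>\<mu>)"
    using i j False by (simp add: gram_nth sign_flip_mmul sum_negf)
  finally show ?thesis using False by simp
next
  case True
  have eq: "(\<integral>P. gram r P k k \<partial>\<mu>) = (\<integral>P. gram r P i i \<partial>\<mu>)" if "k < p" for k
  proof -
    have "(\<integral>P. gram r P k k \<partial>\<mu>) = (\<integral>P. gram r (mmul p (row_swap p i k) P) k k \<partial>\<mu>)"
      using i that by (intro haar_stiefel_integral_mmul[symmetric] row_swap_stiefel gram_measurable)
    also have "\<dots> = (\<integral>P. gram r P i i \<partial>\<mu>)"
      using i that by (simp add: gram_nth row_swap_mmul)
    finally show ?thesis .
  qed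
  have "real p * (\<integral>P. gram r P i i \<partial>\<mu>) = (\<Sum>k<p. \<integral>P. gram r P k k \<partial>\<mu>)"
    using eq by simp
  also have "\<dots> = (\<integral>P. (\<Sum>k<p. gram r P k k) \<partial>\<mu>)"
    using haar_stiefel_gram_integrable by (intro Bochner_Integration.integral_sum[symmetric]) auto
  also have "\<dots> = (\<integral>P. real r \<partial>\<mu>)"
  proof (rule integral_cong_AE)
    show "AE P in \<mu>. (\<Sum>k<p. gram r P k k) = real r"
      using haar_stiefel_AE[OF haar]
    proof eventually_elim
      case (elim P)
      have "(\<Sum>k<p. gram r P k k) = (\<Sum>c<r. \<Sum>k<p. (P k c)\<^sup>2)"
        unfolding gram_nth by (subst sum.swap) (simp add: power2_eq_square)
      then show ?case using stiefel_column_norm[OF elim] by simp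
    qed
  qed (auto intro!: haar_stiefel_measurable borel_measurable_sum gram_measurable)
  finally show ?thesis using True i by (simp add: prob_space field_simps)
qed

end

lemma borel_measurable_vecI:
  fixes f :: "'a \<Rightarrow> 'b::euclidean_space ^ 'n::finite"
  assumes "\<And>i. (\<lambda>\<omega>. f \<omega> $ i) \<in> borel_measurable N"
  shows "f \<in> borel_measurable N"
proof (subst borel_measurable_euclidean_space, intro ballI)
  fix b :: "'b ^ 'n" assume "b \<in> Basis"
  then obtain i u where "b = axis i u" by (auto simp: Basis_vec_def)
  then show "(\<lambda>\<omega>. f \<omega> \<bullet> b) \<in> borel_measurable N" using assms[of i] by (simp add: inner_axis)
qed

text \<open>One entry of \<open>P (u P\<^sup>T P' M + w P\<^sup>T G) = P P\<^sup>T (u P' M + w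
  G)\<close>: the change of coordinates between old and new frame disappears after lifting. Taking a
  single row \<open>p\<close> and single columns \<open>M\<close>, \<open>G\<close> lets the same
  identity serve the projections from the right.\<close>

lemma projected_momentum_assoc:
  fixes P P' :: mat and p M G :: "nat \<Rightarrow> real"
  shows "(\<Sum>c<r. p c * (u * (\<Sum>d<r. (\<Sum>k<q. P k c * P' k d) * M d) + w * (\<Sum>k<q. P k c * G k)))
    = (\<Sum>k<q. (\<Sum>c<r. p c * P k c) * (u * (\<Sum>d<r. P' k d * M d) + w * G k))"
proof -
  have "(\<Sum>d<r. (\<Sum>k<q. P k c * P' k d) * M d) = (\<Sum>k<q. P k c * (\<Sum>d<r. P' k d * M d))" for c
    unfolding sum_distrib_right sum_distrib_left by (subst sum.swap) (simp add: mult_ac)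
  then have "(\<Sum>c<r. p c * (u * (\<Sum>d<r. (\<Sum>k<q. P k c * P' k d) * M d) + w * (\<Sum>k<q. P k c * G k)))
      = (\<Sum>c<r. \<Sum>k<q. p c * P k c * (u * (\<Sum>d<r. P' k d * M d) + w * G k))"
    by (simp add: sum_distrib_left sum.distrib distrib_left mult_ac)
  also have "\<dots> = (\<Sum>k<q. (\<Sum>c<r. p c * P k c) * (u * (\<Sum>d<r. P' k d * M d) + w * G k))"
    unfolding sum_distrib_right by (rule sum.swap)
  finally show ?thesis .
qed

section \<open>Layers as blocks of one parameter vector\<close>

locale layered_parameters =
  fixes NL :: nat and m n r :: "nat \<Rightarrow> nat" and idx :: "'k::finite \<Rightarrow> nat \<times> nat \<times> nat"
  assumes idx: "bij_betw idx UNIV {(l, i, j). l < NL \<and> i < m l \<and> j < n l}"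
begin

lemma idx_cases:
  obtains l i j where "idx a = (l, i, j)" "l < NL" "i < m l" "j < n l"
  using bij_betw_apply[OF idx UNIV_I, of a] by auto

lemma inj_idx: "inj idx" and range_idx: "range idx = {(l, i, j). l < NL \<and> i < m l \<and> j < n l}"
  using idx by (auto simp: bij_betw_def)

lemma sum_idx: "(\<Sum>a\<in>UNIV. h (idx a)) = (\<Sum>l<NL. \<Sum>i<m l. \<Sum>j<n l. h (l, i, j))"
proof -
  have "{(l, i, j). l < NL \<and> i < m l \<and> j < n l} = (SIGMA l:{..<NL}. {..<m l} \<times> {..<n l})" by auto
  then have "(\<Sum>a\<in>UNIV. h (idx a)) = (\<Sum>x\<in>(SIGMA l:{..<NL}. {..<m l} \<times> {..<n l}). h x)"
    using sum.reindex_bij_betw[OF idx, of h] by simp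
  also have "\<dots> = (\<Sum>l<NL. \<Sum>y\<in>{..<m l} \<times> {..<n l}. h (l, y))"
    by (subst sum.Sigma) (auto simp: case_prod_beta)
  also have "\<dots> = (\<Sum>l<NL. \<Sum>i<m l. \<Sum>j<n l. h (l, i, j))"
    by (simp add: sum.cartesian_product case_prod_beta)
  finally show ?thesis .
qed

lemma blk_idx: "idx a = (l, i, j) \<Longrightarrow> blk idx u l i j = u $ a"
  by (metis blk_def inj_idx inv_f_f rangeI)

lemma blk_unblk: "l < NL \<Longrightarrow> i < m l \<Longrightarrow> j < n l \<Longrightarrow> blk idx (unblk idx X) l i j = X l i j"
proof -
  assume "l < NL" "i < m l" "j < n l"
  then have "(l, i, j) \<in> range idx" by (simp add: range_idx)
  then obtain a where "idx a = (l, i, j)" by (metis imageE)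
  then show ?thesis by (simp add: blk_idx) (simp add: unblk_def)
qed

lemma norm_sq_blk: "(norm u)\<^sup>2 = (\<Sum>l<NL. frob_sq (m l) (n l) (blk idx u l))"
proof -
  have "(norm u)\<^sup>2 = (\<Sum>a\<in>UNIV. (\<lambda>(l, i, j). (blk idx u l i j)\<^sup>2) (idx a))"
    unfolding power2_norm_eq_inner inner_vec_def
    by (intro sum.cong) (auto simp: blk_idx power2_eq_square split: prod.split)
  also have "\<dots> = (\<Sum>l<NL. frob_sq (m l) (n l) (blk idx u l))"
    by (subst sum_idx) (simp add: frob_sq_def)
  finally show ?thesis .
qed

text \<open>In coordinates (layer, row, column), the matrix of the map sending each block
  \<open>X\<close> to \<open>P P\<^sup>T X\<close> or \<open>X Q Q\<^sup>T\<close>: block-diagonal,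
  each block a Kronecker product with an identity.\<close>

definition proj_entry :: "(nat \<Rightarrow> mat) \<Rightarrow> (nat \<Rightarrow> mat) \<Rightarrow> nat \<times> nat \<times> nat \<Rightarrow> nat \<times> nat \<times> nat \<Rightarrow> real" where
  "proj_entry P Q = (\<lambda>(l, i, j) (l', i', j'). if l = l' then
      if m l \<le> n l then if j = j' then gram (r l) (P l) i i' else 0
      else if i = i' then gram (r l) (Q l) j j' else 0
    else 0)"

definition proj_matrix :: "(nat \<Rightarrow> mat) \<Rightarrow> (nat \<Rightarrow> mat) \<Rightarrow> real ^ 'k ^ 'k" where
  "proj_matrix P Q = (\<chi> a b. proj_entry P Q (idx a) (idx b))"

lemma sum_proj_entry:
  assumes "l < NL" "i < m l" "j < n l"
  shows "(\<Sum>a\<in>UNIV. proj_entry P Q (l, i, j) (idx a) * h (idx a))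
    = (if m l \<le> n l then \<Sum>k<m l. gram (r l) (P l) i k * h (l, k, j)
       else \<Sum>k<n l. gram (r l) (Q l) j k * h (l, i, k))"
proof -
  let ?s = "\<lambda>l'. \<Sum>i'<m l'. \<Sum>j'<n l'. proj_entry P Q (l, i, j) (l', i', j') * h (l', i', j')"
  have "(\<Sum>a\<in>UNIV. proj_entry P Q (l, i, j) (idx a) * h (idx a)) = (\<Sum>l'<NL. ?s l')"
    by (rule sum_idx)
  also have "\<dots> = (\<Sum>l'<NL. if l' = l then ?s l else 0)"
    by (intro sum.cong) (auto simp: proj_entry_def)
  also have "\<dots> = ?s l" using assms by simp
  also have "\<dots> = (if m l \<le> n l then \<Sum>k<m l. gram (r l) (P l) i k * h (l, k, j)
       else \<Sum>k<n l. gram (r l) (Q l) j k * h (l, i, k))"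
  proof (cases "m l \<le> n l")
    case True
    then have "?s l = (\<Sum>i'<m l. \<Sum>j'<n l. if j' = j then gram (r l) (P l) i i' * h (l, i', j) else 0)"
      by (intro sum.cong refl) (auto simp: proj_entry_def)
    with True assms show ?thesis by simp
  next
    case False
    then have "?s l = (\<Sum>i'<m l. if i' = i then \<Sum>j'<n l. gram (r l) (Q l) j j' * h (l, i, j') else 0)"
      by (intro sum.cong refl) (auto simp: proj_entry_def)
    with False assms show ?thesis by simp
  qed
  finally show ?thesis .
qed

lemma proj_matrix_apply:
  assumes "idx a = (l, i, j)" "l < NL" "i < m l" "j < n l"
  shows "(proj_matrix P Q *v u) $ a
    = (if m l \<le> n l then \<Sum>k<m l. gram (r l) (P l) i k * blk idx u l k j
       else \<Sum>k<n l. gram (r l) (Q l) j k * blk idx u l i k)"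
proof -
  have "(proj_matrix P Q *v u) $ a
      = (\<Sum>b\<in>UNIV. proj_entry P Q (l, i, j) (idx b) * (\<lambda>(l, i, j). blk idx u l i j) (idx b))"
    unfolding matrix_vector_mult_def proj_matrix_def using assms
    by (auto intro!: sum.cong simp: blk_idx split: prod.split)
  then show ?thesis using sum_proj_entry[OF assms(2-), of P Q "\<lambda>(l, i, j). blk idx u l i j"] by simp
qed

lemma orthogonal_projection_proj_matrix:
  assumes P: "\<And>l. l < NL \<Longrightarrow> P l \<in> stiefel (m l) (r l)" and Q: "\<And>l. l < NL \<Longrightarrow> Q l \<in> stiefel (n l) (r l)"
  shows "orthogonal_projection (proj_matrix P Q)"
  unfolding orthogonal_projection_def
proof
  have "proj_entry P Q s s' = proj_entry P Q s' s" for s s'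
    by (cases s; cases s') (auto simp: proj_entry_def gram_sym)
  then show "transpose (proj_matrix P Q) = proj_matrix P Q"
    by (simp add: transpose_def proj_matrix_def vec_eq_iff)
  have "(\<Sum>c\<in>UNIV. proj_entry P Q (idx a) (idx c) * proj_entry P Q (idx c) (idx b))
      = proj_entry P Q (idx a) (idx b)" for a b
  proof (rule idx_cases[of a], rule idx_cases[of b])
    fix l i j l' i' j'
    assume a: "idx a = (l, i, j)" "l < NL" "i < m l" "j < n l"
      and b: "idx b = (l', i', j')" "l' < NL" "i' < m l'" "j' < n l'"
    \<comment> \<open>The sum over the middle index collapses to a single block, where
      \<open>gram_idem\<close> applies; for different layers both sides are zero.\<close>
    show ?thesis
      using sum_proj_entry[OF a(2-), of P Q "\<lambda>s. proj_entry P Q s (idx b)"]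
        gram_idem[OF P[OF a(2)], of i i'] gram_idem[OF Q[OF a(2)], of j j']
      unfolding a(1) b(1) by (auto simp: proj_entry_def)
  qed
  then show "proj_matrix P Q ** proj_matrix P Q = proj_matrix P Q"
    by (simp add: matrix_matrix_mult_def proj_matrix_def vec_eq_iff)
qed

lemma proj_matrix_measurable:
  assumes P: "\<And>l. l < NL \<Longrightarrow> P l \<in> measurable N mat_M" and Q: "\<And>l. l < NL \<Longrightarrow> Q l \<in> measurable N mat_M"
  shows "(\<lambda>\<omega>. proj_matrix (\<lambda>l. P l \<omega>) (\<lambda>l. Q l \<omega>)) \<in> borel_measurable N"
proof (intro borel_measurable_vecI)
  fix a b
  obtain l i j where "idx a = (l, i, j)" "l < NL" by (rule idx_cases)
  moreover obtain l' i' j' where "idx b = (l', i', j')" by (rule idx_cases)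
  ultimately show "(\<lambda>\<omega>. proj_matrix (\<lambda>l. P l \<omega>) (\<lambda>l. Q l \<omega>) $ a $ b) \<in> borel_measurable N"
    using measurable_compose[OF P gram_measurable, of l "r l"] measurable_compose[OF Q gram_measurable, of l "r l"]
    by (auto simp: proj_matrix_def proj_entry_def)
qed

text \<open>The mean projection is diagonal, with entry \<open>r / min m n\<close> taken from the
  layer of the coordinate, because each layer projects its shorter side. Hence the mean of
  \<open>u \<bullet> (A *v u)\<close> is at least \<open>\<delta>\<close> times the squared norm of
  \<open>u\<close>, and the squared residual is the complement of that form.\<close>

lemma proj_matrix_mean:
  assumes "prob_space M"
    and P: "\<And>l. l < NL \<Longrightarrow> P l \<in> measurable M mat_M \<and> haar_stiefel (m l) (r l) (distr M mat_M (P l))"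
    and Q: "\<And>l. l < NL \<Longrightarrow> Q l \<in> measurable M mat_M \<and> haar_stiefel (n l) (r l) (distr M mat_M (Q l))"
    and \<delta>: "\<And>l. l < NL \<Longrightarrow> \<delta> \<le> real (r l) / real (min (m l) (n l))"
  shows "AE \<omega> in M. orthogonal_projection (proj_matrix (\<lambda>l. P l \<omega>) (\<lambda>l. Q l \<omega>))"
    and "(\<integral>\<^sup>+\<omega>. ennreal ((norm (u - proj_matrix (\<lambda>l. P l \<omega>) (\<lambda>l. Q l \<omega>) *v u))\<^sup>2) \<partial>M)
      \<le> ennreal ((1 - \<delta>) * (norm u)\<^sup>2)"
proof -
  interpret prob_space M by fact
  let ?A = "\<lambda>\<omega>. proj_matrix (\<lambda>l. P l \<omega>) (\<lambda>l. Q l \<omega>)"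
  have "AE \<omega> in M. \<forall>l\<in>{..<NL}. P l \<omega> \<in> stiefel (m l) (r l) \<and> Q l \<omega> \<in> stiefel (n l) (r l)"
    using P Q by (intro AE_finite_allI AE_conjI) (auto intro: AE_distrD[OF _ haar_stiefel_AE])
  then show AE: "AE \<omega> in M. orthogonal_projection (?A \<omega>)"
    by eventually_elim (auto intro: orthogonal_projection_proj_matrix)
  define d where "d a = (case idx a of (l, i, j) \<Rightarrow> real (r l) / real (min (m l) (n l)))" for a
  have entry: "integrable M (\<lambda>\<omega>. ?A \<omega> $ a $ b)" "(\<integral>\<omega>. ?A \<omega> $ a $ b \<partial>M) = (if a = b then d a else 0)" for a b
  proof -
    obtain l i j where a: "idx a = (l, i, j)" "l < NL" "i < m l" "j < n l" by (rule idx_cases)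
    obtain l' i' j' where b: "idx b = (l', i', j')" "l' < NL" "i' < m l'" "j' < n l'" by (rule idx_cases)
    have ab: "a = b \<longleftrightarrow> (l, i, j) = (l', i', j')" using inj_idx a b by (metis inj_eq)
    have Pl: "integrable M (\<lambda>\<omega>. gram (r l) (P l \<omega>) i k)"
      "(\<integral>\<omega>. gram (r l) (P l \<omega>) i k \<partial>M) = (if i = k then real (r l) / real (m l) else 0)" if "k < m l" for k
      using haar_stiefel_gram_integrable[of "m l" "r l" "distr M mat_M (P l)" i k]
        haar_stiefel_gram_integral[of "m l" "r l" "distr M mat_M (P l)" i k] P[OF a(2)] a that
      by (simp_all add: integrable_distr_eq integral_distr)
    have Ql: "integrable M (\<lambda>\<omega>. gram (r l) (Q l \<omega>) j k)"
      "(\<integral>\<omega>. gram (r l) (Q l \<omega>) j k \<partial>M) = (if j = k then real (r l) / real (n l) else 0)" if "k < n l" for k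
      using haar_stiefel_gram_integrable[of "n l" "r l" "distr M mat_M (Q l)" j k]
        haar_stiefel_gram_integral[of "n l" "r l" "distr M mat_M (Q l)" j k] Q[OF a(2)] a that
      by (simp_all add: integrable_distr_eq integral_distr)
    show "integrable M (\<lambda>\<omega>. ?A \<omega> $ a $ b)" "(\<integral>\<omega>. ?A \<omega> $ a $ b \<partial>M) = (if a = b then d a else 0)"
      using a b ab Pl[of i'] Ql[of j']
      by (cases "l = l'"; cases "m l \<le> n l"; cases "i = i'"; cases "j = j'";
          simp add: proj_matrix_def proj_entry_def d_def)+
  qed
  have form: "u \<bullet> (?A \<omega> *v u) = (\<Sum>a\<in>UNIV. \<Sum>b\<in>UNIV. u $ a * u $ b * ?A \<omega> $ a $ b)" for \<omega>
    by (simp add: inner_vec_def matrix_vector_mult_def sum_distrib_left mult_ac)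
  have int: "integrable M (\<lambda>\<omega>. u \<bullet> (?A \<omega> *v u))"
    unfolding form using entry by (intro Bochner_Integration.integrable_sum integrable_mult_right)
  have "(\<integral>\<omega>. u \<bullet> (?A \<omega> *v u) \<partial>M) = (\<Sum>a\<in>UNIV. \<Sum>b\<in>UNIV. u $ a * u $ b * (if a = b then d a else 0))"
    unfolding form using entry by (simp add: Bochner_Integration.integral_sum)
  also have "\<dots> = (\<Sum>a\<in>UNIV. d a * (u $ a * u $ a))"
    by (simp add: if_distrib[of "\<lambda>x. _ * x"] mult_ac cong: if_cong)
  also have "\<dots> \<ge> (\<Sum>a\<in>UNIV. \<delta> * (u $ a * u $ a))"
  proof (intro sum_mono mult_right_mono)
    show "\<delta> \<le> d a" for a by (rule idx_cases[of a]) (simp add: d_def \<delta>)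
  qed simp
  also have "(\<Sum>a\<in>UNIV. \<delta> * (u $ a * u $ a)) = \<delta> * (norm u)\<^sup>2"
    by (simp add: power2_norm_eq_inner inner_vec_def sum_distrib_left)
  finally have mean: "\<delta> * (norm u)\<^sup>2 \<le> (\<integral>\<omega>. u \<bullet> (?A \<omega> *v u) \<partial>M)" .
  have res: "AE \<omega> in M. (norm (u - ?A \<omega> *v u))\<^sup>2 = (norm u)\<^sup>2 - u \<bullet> (?A \<omega> *v u)"
    using AE by eventually_elim (rule orthogonal_projection_residual)
  have "(\<integral>\<^sup>+\<omega>. ennreal ((norm (u - ?A \<omega> *v u))\<^sup>2) \<partial>M) = (\<integral>\<^sup>+\<omega>. ennreal ((norm u)\<^sup>2 - u \<bullet> (?A \<omega> *v u)) \<partial>M)"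
    using res by (intro nn_integral_cong_AE) auto
  also have "\<dots> = ennreal (\<integral>\<omega>. (norm u)\<^sup>2 - u \<bullet> (?A \<omega> *v u) \<partial>M)"
  proof (intro nn_integral_eq_integral)
    show "AE \<omega> in M. 0 \<le> (norm u)\<^sup>2 - u \<bullet> (?A \<omega> *v u)"
      using res by eventually_elim (metis zero_le_power2)
  qed (use int in auto)
  also have "\<dots> \<le> ennreal ((1 - \<delta>) * (norm u)\<^sup>2)"
    using mean int by (intro ennreal_leI) (simp add: prob_space algebra_simps)
  finally show "(\<integral>\<^sup>+\<omega>. ennreal ((norm (u - ?A \<omega> *v u))\<^sup>2) \<partial>M) \<le> ennreal ((1 - \<delta>) * (norm u)\<^sup>2)" .
qed

text \<open>The state after \<open>t\<close> steps stores the momentum of step \<open>t - 1\<close>,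
  so it is lifted with the frame of that step's period. For \<open>t = 0\<close> the subtraction
  truncates to period 0, harmlessly, since the stored momentum is zero.\<close>

definition full_momentum ::
  "nat \<Rightarrow> real \<Rightarrow> real \<Rightarrow> (real ^ 'k \<Rightarrow> 'xi \<Rightarrow> real ^ 'k) \<Rightarrow> real ^ 'k \<Rightarrow> (nat \<Rightarrow> 'xi) \<Rightarrow>
    (nat \<Rightarrow> nat \<Rightarrow> mat) \<Rightarrow> (nat \<Rightarrow> nat \<Rightarrow> mat) \<Rightarrow> nat \<Rightarrow> real ^ 'k" where
  "full_momentum \<tau> \<beta> \<eta> gF x0 xi P Q t = unblk idx (\<lambda>l.
    if m l \<le> n l then mmul (r l) (P ((t - 1) div \<tau>) l) (snd (golore_state \<tau> \<beta> \<eta> m n r idx gF x0 xi P Q t) l)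
    else mmul (r l) (snd (golore_state \<tau> \<beta> \<eta> m n r idx gF x0 xi P Q t) l) (mtr (Q ((t - 1) div \<tau>) l)))"

lemma golore_x_0: "golore_x \<tau> \<beta> \<eta> m n r idx gF x0 xi P Q 0 = x0"
  by (simp add: golore_x_def)

lemma full_momentum_0: "full_momentum \<tau> \<beta> \<eta> gF x0 xi P Q 0 = 0"
  by (simp add: full_momentum_def unblk_def mmul_def mzero_def vec_eq_iff split: prod.split)

lemma golore_x_Suc:
  "golore_x \<tau> \<beta> \<eta> m n r idx gF x0 xi P Q (Suc t)
    = golore_x \<tau> \<beta> \<eta> m n r idx gF x0 xi P Q t - \<eta> *\<^sub>R full_momentum \<tau> \<beta> \<eta> gF x0 xi P Q (Suc t)"
  by (simp add: golore_x_def full_momentum_def golore_step_def Let_def cong: if_cong)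

lemma full_momentum_Suc:
  "full_momentum \<tau> \<beta> \<eta> gF x0 xi P Q (Suc t) = proj_matrix (P (t div \<tau>)) (Q (t div \<tau>))
    *v ((1 - \<beta>) *\<^sub>R full_momentum \<tau> \<beta> \<eta> gF x0 xi P Q t + \<beta> *\<^sub>R gF (golore_x \<tau> \<beta> \<eta> m n r idx gF x0 xi P Q t) (xi t))"
  (is "_ = ?A *v ?w")
proof (subst vec_eq_iff, intro allI)
  fix a
  let ?M = "snd (golore_state \<tau> \<beta> \<eta> m n r idx gF x0 xi P Q t)"
  let ?G = "gF (golore_x \<tau> \<beta> \<eta> m n r idx gF x0 xi P Q t) (xi t)"
  obtain l i j where a: "idx a = (l, i, j)" "l < NL" "i < m l" "j < n l" by (rule idx_cases)
  have w: "blk idx ?w l i' j' = (1 - \<beta>) * (if m l \<le> n l then \<Sum>d<r l. P ((t - 1) div \<tau>) l i' d * ?M l d j'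
      else \<Sum>d<r l. ?M l i' d * Q ((t - 1) div \<tau>) l j' d) + \<beta> * blk idx ?G l i' j'"
    if "i' < m l" "j' < n l" for i' j'
  proof -
    have "blk idx ?w l i' j' = (1 - \<beta>) * blk idx (full_momentum \<tau> \<beta> \<eta> gF x0 xi P Q t) l i' j' + \<beta> * blk idx ?G l i' j'"
      by (simp add: blk_def)
    then show ?thesis using a that by (simp add: full_momentum_def blk_unblk mmul_def mtr_def)
  qed
  show "full_momentum \<tau> \<beta> \<eta> gF x0 xi P Q (Suc t) $ a = (?A *v ?w) $ a"
  proof (cases "m l \<le> n l")
    case True
    have "full_momentum \<tau> \<beta> \<eta> gF x0 xi P Q (Suc t) $ a = (\<Sum>c<r l. P (t div \<tau>) l i c *
        ((1 - \<beta>) * (\<Sum>d<r l. (\<Sum>k<m l. P (t div \<tau>) l k c * P ((t - 1) div \<tau>) l k d) * ?M l d j)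
          + \<beta> * (\<Sum>k<m l. P (t div \<tau>) l k c * blk idx ?G l k j)))"
      using a True by (simp add: full_momentum_def unblk_def golore_step_def Let_def mmul_def mtr_def mlin_def golore_x_def)
    also have "\<dots> = (?A *v ?w) $ a"
      unfolding projected_momentum_assoc proj_matrix_apply[OF a] using True a w by (simp add: gram_nth)
    finally show ?thesis .
  next
    case False
    have "full_momentum \<tau> \<beta> \<eta> gF x0 xi P Q (Suc t) $ a = (\<Sum>c<r l. Q (t div \<tau>) l j c *
        ((1 - \<beta>) * (\<Sum>k<n l. (\<Sum>d<r l. ?M l i d * Q ((t - 1) div \<tau>) l k d) * Q (t div \<tau>) l k c)
          + \<beta> * (\<Sum>k<n l. Q (t div \<tau>) l k c * blk idx ?G l i k)))"
      using a False by (simp add: full_momentum_def unblk_def golore_step_def Let_def mmul_def mtr_def mlin_def golore_x_def mult.commute)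
    \<comment> \<open>The update from the right multiplies in the opposite order; exchanging the two
      sums brings it to the shape of \<open>projected_momentum_assoc\<close>.\<close>
    also have "\<dots> = (\<Sum>c<r l. Q (t div \<tau>) l j c *
        ((1 - \<beta>) * (\<Sum>d<r l. (\<Sum>k<n l. Q (t div \<tau>) l k c * Q ((t - 1) div \<tau>) l k d) * ?M l i d)
          + \<beta> * (\<Sum>k<n l. Q (t div \<tau>) l k c * blk idx ?G l i k)))"
    proof -
      have "(\<Sum>k<n l. (\<Sum>d<r l. ?M l i d * Q ((t - 1) div \<tau>) l k d) * Q (t div \<tau>) l k c)
          = (\<Sum>d<r l. (\<Sum>k<n l. Q (t div \<tau>) l k c * Q ((t - 1) div \<tau>) l k d) * ?M l i d)" for c
        unfolding sum_distrib_right by (subst sum.swap) (simp add: mult_ac)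
      then show ?thesis by simp
    qed
    also have "\<dots> = (?A *v ?w) $ a"
      unfolding projected_momentum_assoc proj_matrix_apply[OF a] using False a w by (simp add: gram_nth mult.commute)
    finally show ?thesis .
  qed
qed

end

section \<open>The iterates of the algorithm\<close>

lemma Int_stable_rv_sets: "Int_stable (rv_sets M N X)"
proof (rule Int_stableI)
  fix a b assume "a \<in> rv_sets M N X" "b \<in> rv_sets M N X"
  then obtain A B where "a = X -` A \<inter> space M" "A \<in> sets N" "b = X -` B \<inter> space M" "B \<in> sets N"
    by (auto simp: rv_sets_def)
  then have "a \<inter> b = X -` (A \<inter> B) \<inter> space M" "A \<inter> B \<in> sets N" by auto
  then show "a \<inter> b \<in> rv_sets M N X" unfolding rv_sets_def by blast
qed

lemma measurable_sigma_rv_sets: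
  assumes X: "X \<in> measurable M N" and G: "rv_sets M N X \<subseteq> G" "G \<subseteq> Pow (space M)"
  shows "X \<in> measurable (sigma (space M) G) N"
proof (rule measurableI)
  show "X \<omega> \<in> space N" if "\<omega> \<in> space (sigma (space M) G)" for \<omega>
    using measurable_space[OF X] that G by (simp add: space_measure_of_conv)
  show "X -` A \<inter> space (sigma (space M) G) \<in> sets (sigma (space M) G)" if "A \<in> sets N" for A
    using that G by (auto simp: space_measure_of_conv rv_sets_def intro!: sigma_sets.Basic)
qed

text \<open>\<open>N\<close> is arbitrary because it will be a sigma-algebra generated by past
  samples and frames: the iterates are adapted, and the independence claims rest on this.\<close>

lemma momentum_state_measurable:
  fixes x m :: "nat \<Rightarrow> 'w \<Rightarrow> real ^ 'k::finite"
  assumes x_0: "\<And>\<omega>. x 0 \<omega> = x0" and m_0: "\<And>\<omega>. m 0 \<omega> = 0"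
    and m_Suc: "\<And>t \<omega>. m (Suc t) \<omega> = A (t div \<tau>) \<omega> *v ((1 - \<beta>) *\<^sub>R m t \<omega> + \<beta> *\<^sub>R gF (x t \<omega>) (xi t \<omega>))"
    and x_Suc: "\<And>t \<omega>. x (Suc t) \<omega> = x t \<omega> - \<eta> *\<^sub>R m (Suc t) \<omega>"
    and gF: "(\<lambda>(z, y). gF z y) \<in> borel_measurable (borel \<Otimes>\<^sub>M D)"
    and xi: "\<And>s. s < t \<Longrightarrow> xi s \<in> measurable N D"
    and A: "\<And>s. s < t \<Longrightarrow> A (s div \<tau>) \<in> borel_measurable N"
  shows "s \<le> t \<Longrightarrow> x s \<in> borel_measurable N \<and> m s \<in> borel_measurable N"
proof (induction s)
  case 0
  have "x 0 = (\<lambda>_. x0)" "m 0 = (\<lambda>_. 0)" using x_0 m_0 by auto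
  then show ?case by simp
next
  case (Suc s)
  then have IH [measurable]: "x s \<in> borel_measurable N" "m s \<in> borel_measurable N" by auto
  have [measurable]: "xi s \<in> measurable N D" "A (s div \<tau>) \<in> borel_measurable N" using xi A Suc by auto
  have [measurable]: "(\<lambda>\<omega>. gF (x s \<omega>) (xi s \<omega>)) \<in> borel_measurable N"
    using measurable_compose[OF measurable_Pair[OF IH(1) \<open>xi s \<in> _\<close>] gF] by simp
  have [measurable]: "m (Suc s) \<in> borel_measurable N" unfolding m_Suc[abs_def] by measurable
  show ?case unfolding x_Suc[abs_def] by measurable
qed

lemma delta_min_props:
  assumes rank: "\<forall>l<NL. 1 \<le> r l \<and> r l < min (m l) (n l)" and NL: "0 < NL"
  shows "0 < delta_min NL m n r" "delta_min NL m n r \<le> 1"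
    "\<And>l. l < NL \<Longrightarrow> delta_min NL m n r \<le> real (r l) / real (min (m l) (n l))"
proof -
  have ne: "finite ((\<lambda>l. real (r l) / real (min (m l) (n l))) ` {..<NL})"
    "(\<lambda>l. real (r l) / real (min (m l) (n l))) ` {..<NL} \<noteq> {}" using NL by auto
  show le: "delta_min NL m n r \<le> real (r l) / real (min (m l) (n l))" if "l < NL" for l
    unfolding delta_min_def using ne that by (intro Min_le) auto
  show "0 < delta_min NL m n r"
    unfolding delta_min_def Min_gr_iff[OF ne] using rank by (auto intro!: divide_pos_pos)
  have "real (r 0) / real (min (m 0) (n 0)) \<le> 1" using rank NL by (auto simp: divide_le_eq_1)
  then show "delta_min NL m n r \<le> 1" using le[OF NL] by linarith
qed

text \<open>The expectations are nonnegative integrals, so the bound includes finiteness of each of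
  them. The lifted iteration is shown to be an instance of \<open>subspace_momentum\<close>, with
  \<open>delta_min\<close> as \<open>\<delta>\<close> and the sum of the layer variances as
  \<open>v\<close>.\<close>

theorem theoremB4:
  fixes M :: "'w measure" and D :: "'xi measure"
    and NL :: nat and m n r :: "nat \<Rightarrow> nat"
    and idx :: "'k::finite \<Rightarrow> nat \<times> nat \<times> nat"
    and F :: "real ^ 'k \<Rightarrow> 'xi \<Rightarrow> real" and gF :: "real ^ 'k \<Rightarrow> 'xi \<Rightarrow> real ^ 'k"
    and f :: "real ^ 'k \<Rightarrow> real" and gradf :: "real ^ 'k \<Rightarrow> real ^ 'k"
    and L :: real and \<sigma> :: "nat \<Rightarrow> real"
    and x0 :: "real ^ 'k"
    and xi :: "nat \<Rightarrow> 'w \<Rightarrow> 'xi" and Ps Qs :: "nat \<Rightarrow> nat \<Rightarrow> 'w \<Rightarrow> mat"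
    and \<beta>\<^sub>1 \<eta> :: real and \<tau> K :: nat
  assumes idx: "bij_betw idx UNIV {(l, i, j). l < NL \<and> i < m l \<and> j < n l}"
    and rank: "\<forall>l<NL. 1 \<le> r l \<and> r l < min (m l) (n l)"
    \<comment> \<open>stochastic oracle and objective\<close>
    and D: "prob_space D"
    and F_int: "\<forall>x. integrable D (F x)"
    and f_def: "\<forall>x. f x = (\<integral>\<xi>. F x \<xi> \<partial>D)"
    and F_grad: "\<forall>x \<xi>. ((\<lambda>y. F y \<xi>) has_derivative (\<lambda>h. gF x \<xi> \<bullet> h)) (at x)"
    and f_grad: "\<forall>x. (f has_derivative (\<lambda>h. gradf x \<bullet> h)) (at x)"
    \<comment> \<open>Assumption 1\<close>
    and A1: "bdd_below (range f)"
    \<comment> \<open>Assumption 2\<close>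
    and A2: "\<forall>x y. norm (gradf x - gradf y) \<le> L * norm (x - y)"
    \<comment> \<open>Assumption 3\<close>
    and A3_mean: "\<forall>x. integrable D (gF x) \<and> (\<integral>\<xi>. gF x \<xi> \<partial>D) = gradf x"
    and A3_var: "\<forall>x. \<forall>l<NL. (\<integral>\<^sup>+\<xi>. ennreal (frob_sq (m l) (n l) (blk idx (gF x \<xi> - gradf x) l)) \<partial>D)
                       \<le> ennreal ((\<sigma> l)\<^sup>2)"
    \<comment> \<open>randomness of the algorithm\<close>
    and M: "prob_space M"
    and xi_rv: "\<forall>t. xi t \<in> measurable M D \<and> distr M D (xi t) = D"
    and P_rv: "\<forall>k. \<forall>l<NL. Ps k l \<in> measurable M mat_M \<and> haar_stiefel (m l) (r l) (distr M mat_M (Ps k l))"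
    and Q_rv: "\<forall>k. \<forall>l<NL. Qs k l \<in> measurable M mat_M \<and> haar_stiefel (n l) (r l) (distr M mat_M (Qs k l))"
    and indep: "prob_space.indep_sets M
        (\<lambda>i. case i of Inl t \<Rightarrow> rv_sets M D (xi t)
                   | Inr (Inl (k, l)) \<Rightarrow> rv_sets M mat_M (Ps k l)
                   | Inr (Inr (k, l)) \<Rightarrow> rv_sets M mat_M (Qs k l))
        (range Inl \<union> Inr ` Inl ` {(k, l). l < NL} \<union> Inr ` Inr ` {(k, l). l < NL})"
    \<comment> \<open>hyperparameters\<close>
    and beta: "0 < \<beta>\<^sub>1" "\<beta>\<^sub>1 \<le> 1"
    and tau: "real \<tau> \<ge> 64 / (3 * \<beta>\<^sub>1 * delta_min NL m n r)"
    and eta: "0 < \<eta>"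
      "\<eta> \<le> Min {1 / (4 * L),
                 sqrt (3 * delta_min NL m n r * \<beta>\<^sub>1\<^sup>2 / (80 * L\<^sup>2)),
                 sqrt (3 * delta_min NL m n r / (80 * (real \<tau>)\<^sup>2 * L\<^sup>2)),
                 sqrt (3 * \<beta>\<^sub>1 / (16 * real \<tau> * L\<^sup>2))}"
    and K: "1 \<le> K"
  shows "(\<Sum>t<K * \<tau>. \<integral>\<^sup>+\<omega>. ennreal ((norm (gradf
              (golore_x \<tau> \<beta>\<^sub>1 \<eta> m n r idx gF x0 (\<lambda>s. xi s \<omega>) (\<lambda>k l. Ps k l \<omega>) (\<lambda>k l. Qs k l \<omega>) t)))\<^sup>2) \<partial>M)
           / ennreal (real (K * \<tau>))
         \<le> ennreal (16 * (f x0 - Inf (range f)) / (delta_min NL m n r * \<eta> * real K * real \<tau>)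
                    + 32 * \<beta>\<^sub>1 * (\<Sum>l<NL. (\<sigma> l)\<^sup>2) / (3 * delta_min NL m n r))"
proof -
  interpret M: prob_space M by fact
  interpret layered_parameters NL m n r idx using idx by unfold_locales
  let ?\<delta> = "delta_min NL m n r" and ?v = "\<Sum>l<NL. (\<sigma> l)\<^sup>2"
  \<comment> \<open>The coordinate type is nonempty, so there is a layer and
    \<open>delta_min\<close> is a minimum over a nonempty set.\<close>
  have "0 < NL"
  proof -
    obtain l i j where "idx undefined = (l, i, j)" "l < NL" by (rule idx_cases)
    then show ?thesis by simp
  qed
  note \<delta> = delta_min_props[OF rank this]
  have "\<eta> \<le> 1 / (4 * L)" and \<eta>2: "\<eta> \<le> sqrt (3 * ?\<delta> * \<beta>\<^sub>1\<^sup>2 / (80 * L\<^sup>2))"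
    and \<eta>3: "\<eta> \<le> sqrt (3 * ?\<delta> / (80 * (real \<tau>)\<^sup>2 * L\<^sup>2))"
    using eta(2) by auto
  \<comment> \<open>For \<open>L \<le> 0\<close> the bound \<open>1 / (4 * L)\<close> would be at
    most 0, division by zero giving 0; a positive \<open>\<eta>\<close> below it therefore forces
    \<open>L\<close> to be positive.\<close>
  with eta(1) have "0 < 1 / (4 * L)" by linarith
  then have L: "0 < L" by (simp add: zero_less_divide_iff)
  with \<open>\<eta> \<le> 1 / (4 * L)\<close> have \<eta>L: "\<eta> * L \<le> 1 / 4" by (simp add: field_simps)
  have "0 < 64 / (3 * \<beta>\<^sub>1 * ?\<delta>)" using \<delta> beta by simp
  with tau have "0 < real \<tau>" by linarith
  then have \<tau>: "0 < \<tau>" by simp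
  have "\<eta>\<^sup>2 \<le> 3 * ?\<delta> * \<beta>\<^sub>1\<^sup>2 / (80 * L\<^sup>2)" "\<eta>\<^sup>2 \<le> 3 * ?\<delta> / (80 * (real \<tau>)\<^sup>2 * L\<^sup>2)"
    using \<eta>2 \<eta>3 eta(1) by (auto intro!: sqrt_ge_absD)
  then have \<eta>_small: "L\<^sup>2 * \<eta>\<^sup>2 \<le> 3 * ?\<delta> * \<beta>\<^sub>1\<^sup>2 / 80" "L\<^sup>2 * \<eta>\<^sup>2 * (real \<tau>)\<^sup>2 \<le> 3 * ?\<delta> / 80"
    using L \<tau> by (simp_all add: field_simps)

  define A where "A k \<omega> = proj_matrix (\<lambda>l. Ps k l \<omega>) (\<lambda>l. Qs k l \<omega>)" for k \<omega>
  define X where "X t \<omega> = golore_x \<tau> \<beta>\<^sub>1 \<eta> m n r idx gF x0 (\<lambda>s. xi s \<omega>) (\<lambda>k l. Ps k l \<omega>) (\<lambda>k l. Qs k l \<omega>) t" for t \<omega>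
  define W where "W t \<omega> = full_momentum \<tau> \<beta>\<^sub>1 \<eta> gF x0 (\<lambda>s. xi s \<omega>) (\<lambda>k l. Ps k l \<omega>) (\<lambda>k l. Qs k l \<omega>) t" for t \<omega>
  have X_0: "X 0 \<omega> = x0" and W_0: "W 0 \<omega> = 0"
    and W_Suc: "W (Suc t) \<omega> = A (t div \<tau>) \<omega> *v ((1 - \<beta>\<^sub>1) *\<^sub>R W t \<omega> + \<beta>\<^sub>1 *\<^sub>R gF (X t \<omega>) (xi t \<omega>))"
    and X_Suc: "X (Suc t) \<omega> = X t \<omega> - \<eta> *\<^sub>R W (Suc t) \<omega>" for t \<omega>
    unfolding X_def W_def A_def by (rule golore_x_0 full_momentum_0 full_momentum_Suc golore_x_Suc)+
  have gF: "(\<lambda>(z, y). gF z y) \<in> borel_measurable (borel \<Otimes>\<^sub>M D)"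
    by (rule gradient_borel_measurable[of F]) (use F_grad F_int in auto)
  have var: "(\<integral>\<^sup>+\<xi>. ennreal ((norm (gF z \<xi> - gradf z))\<^sup>2) \<partial>D) \<le> ennreal ?v" for z
  proof -
    have [measurable]: "gF z \<in> borel_measurable D" using A3_mean borel_measurable_integrable by blast
    have [measurable]: "(\<lambda>\<xi>. frob_sq (m l) (n l) (blk idx (gF z \<xi> - gradf z) l)) \<in> borel_measurable D" for l
    proof -
      have "(\<lambda>\<xi>. blk idx (gF z \<xi> - gradf z) l i j) \<in> borel_measurable D" for i j
        unfolding blk_def cart_eq_inner_axis by measurable
      then show ?thesis unfolding frob_sq_def by measurable
    qed
    have "(\<integral>\<^sup>+\<xi>. ennreal ((norm (gF z \<xi> - gradf z))\<^sup>2) \<partial>D)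
        = (\<integral>\<^sup>+\<xi>. (\<Sum>l<NL. ennreal (frob_sq (m l) (n l) (blk idx (gF z \<xi> - gradf z) l))) \<partial>D)"
      unfolding norm_sq_blk by (simp add: sum_ennreal frob_sq_def sum_nonneg)
    also have "\<dots> = (\<Sum>l<NL. \<integral>\<^sup>+\<xi>. ennreal (frob_sq (m l) (n l) (blk idx (gF z \<xi> - gradf z) l)) \<partial>D)"
      by (rule nn_integral_sum) measurable
    also have "\<dots> \<le> (\<Sum>l<NL. ennreal ((\<sigma> l)\<^sup>2))" using A3_var by (intro sum_mono) auto
    also have "\<dots> = ennreal ?v" by (simp add: sum_ennreal)
    finally show ?thesis .
  qed

  define E where "E i = (case i of Inl t \<Rightarrow> rv_sets M D (xi t)
                   | Inr (Inl (k, l)) \<Rightarrow> rv_sets M mat_M (Ps k l)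
                   | Inr (Inr (k, l)) \<Rightarrow> rv_sets M mat_M (Qs k l))" for i
  define I :: "(nat + nat \<times> nat + nat \<times> nat) set" where "I = range Inl \<union> Inr ` Inl ` {(k, l). l < NL} \<union> Inr ` Inr ` {(k, l). l < NL}"
  \<comment> \<open>\<open>H T N\<close> indexes the samples at times in \<open>T\<close> and the
    frames of all layers drawn for periods in \<open>N\<close>. Each independence claim becomes
    disjointness of two such sets plus measurability with respect to the generated sigma-algebras
    \<open>?S T N\<close>.\<close>
  define H where "H T N = Inl ` T \<union> Inr ` Inl ` {(k, l). k \<in> N \<and> l < NL} \<union> Inr ` Inr ` {(k, l). k \<in> N \<and> l < NL}"
    for T N :: "nat set"
  have indep_E: "M.indep_sets E I" using indep by (simp add: E_def[abs_def] I_def)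
  have stable: "Int_stable (E i)" for i
    by (auto simp: E_def Int_stable_rv_sets split: sum.split)
  have HI: "H T N \<subseteq> I" for T N by (auto simp: H_def I_def)
  let ?S = "\<lambda>T N. sigma (space M) (\<Union>i\<in>H T N. E i)"
  have E_Pow: "(\<Union>i\<in>H T N. E i) \<subseteq> Pow (space M)" for T N
    using indep_E HI[of T N] sets.space_closed[of M] unfolding M.indep_sets_def by blast
  have xi_S: "xi s \<in> measurable (?S T N) D" if "s \<in> T" for s T N
  proof (rule measurable_sigma_rv_sets[OF _ _ E_Pow])
    have "Inl s \<in> H T N" using that by (simp add: H_def)
    then show "rv_sets M D (xi s) \<subseteq> (\<Union>i\<in>H T N. E i)" by (force simp: E_def)
  qed (use xi_rv in auto)
  have A_S: "A k \<in> borel_measurable (?S T N)" if "k \<in> N" for k T N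
    unfolding A_def[abs_def]
  proof (rule proj_matrix_measurable)
    fix l assume l: "l < NL"
    show "Ps k l \<in> measurable (?S T N) mat_M"
    proof (rule measurable_sigma_rv_sets[OF _ _ E_Pow])
      have "Inr (Inl (k, l)) \<in> H T N" using that l by (auto simp: H_def)
      then show "rv_sets M mat_M (Ps k l) \<subseteq> (\<Union>i\<in>H T N. E i)" by (force simp: E_def)
    qed (use P_rv l in auto)
    show "Qs k l \<in> measurable (?S T N) mat_M"
    proof (rule measurable_sigma_rv_sets[OF _ _ E_Pow])
      have "Inr (Inr (k, l)) \<in> H T N" using that l by (auto simp: H_def)
      then show "rv_sets M mat_M (Qs k l) \<subseteq> (\<Union>i\<in>H T N. E i)" by (force simp: E_def)
    qed (use Q_rv l in auto)
  qed
  have state_S: "X t \<in> borel_measurable (?S T N) \<and> W t \<in> borel_measurable (?S T N)"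
    if "{..<t} \<subseteq> T" "\<And>s. s < t \<Longrightarrow> s div \<tau> \<in> N" for t T N
    by (rule momentum_state_measurable[OF X_0 W_0 W_Suc X_Suc gF, where t = t]) (use that xi_S A_S in auto)
  \<comment> \<open>The past consists of the samples before \<open>t\<close> and the frames of all
    periods up to and including the current one; a frame drawn at time \<open>t\<close> itself thus
    stands apart from the sample \<open>xi t\<close>.\<close>
  have indep_xi: "M.independent_rvs (borel \<Otimes>\<^sub>M (borel \<Otimes>\<^sub>M borel)) (\<lambda>\<omega>. (X t \<omega>, W t \<omega>, A (t div \<tau>) \<omega>)) D (xi t)" for t
  proof (rule M.independent_rvs_of_indep_sets[OF indep_E stable HI HI])
    show "H {..<t} {..t div \<tau>} \<inter> H {t} {} = {}" by (auto simp: H_def)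
    have "X t \<in> borel_measurable (?S {..<t} {..t div \<tau>})" "W t \<in> borel_measurable (?S {..<t} {..t div \<tau>})"
      using state_S[of t "{..<t}" "{..t div \<tau>}"] by (auto simp: div_le_mono)
    then show "(\<lambda>\<omega>. (X t \<omega>, W t \<omega>, A (t div \<tau>) \<omega>)) \<in> measurable (?S {..<t} {..t div \<tau>}) (borel \<Otimes>\<^sub>M (borel \<Otimes>\<^sub>M borel))"
      using A_S[of "t div \<tau>" "{..t div \<tau>}" "{..<t}"] by (intro measurable_Pair) auto
    show "xi t \<in> measurable (?S {t} {}) D" by (rule xi_S) simp
  qed
  \<comment> \<open>Every time before \<open>k * \<tau>\<close> lies in a period before
    \<open>k\<close>, so the iterate at \<open>k * \<tau>\<close> is built without the frames of
    period \<open>k\<close>.\<close>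
  have indep_A: "M.independent_rvs borel (X (k * \<tau>)) borel (A k)" for k
  proof (rule M.independent_rvs_of_indep_sets[OF indep_E stable HI HI])
    show "H {..<k * \<tau>} {..<k} \<inter> H {} {k} = {}" by (auto simp: H_def)
    show "X (k * \<tau>) \<in> borel_measurable (?S {..<k * \<tau>} {..<k})"
      using state_S[of "k * \<tau>" "{..<k * \<tau>}" "{..<k}"] by (auto simp: less_mult_imp_div_less)
    show "A k \<in> borel_measurable (?S {} {k})" by (rule A_S) simp
  qed

  have mean: "integrable D (gF z)" "(\<integral>\<xi>. gF z \<xi> \<partial>D) = gradf z"
    and lip: "norm (gradf y - gradf z) \<le> L * norm (y - z)" and xi_D: "distr M D (xi t) = D" for y z t
    using A3_mean A2 xi_rv by blast+
  have proj: "AE \<omega> in M. orthogonal_projection (A k \<omega>)" for k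
    unfolding A_def by (rule proj_matrix_mean(1)[OF M _ _ \<delta>(3)]) (use P_rv Q_rv in auto)
  have proj_mean: "(\<integral>\<^sup>+\<omega>. ennreal ((norm (u - A k \<omega> *v u))\<^sup>2) \<partial>M) \<le> ennreal ((1 - ?\<delta>) * (norm u)\<^sup>2)" for u k
    unfolding A_def by (rule proj_matrix_mean(2)[OF M _ _ \<delta>(3)]) (use P_rv Q_rv in auto)
  have v: "0 \<le> ?v" by (simp add: sum_nonneg)
  interpret subspace_momentum M D gF gradf L ?v \<beta>\<^sub>1 \<eta> ?\<delta> \<tau> xi A x0 X W
    by (rule subspace_momentum.intro[OF M subspace_momentum_axioms.intro])
      (fact X_0 W_0 W_Suc X_Suc D xi_D gF mean var v lip proj proj_mean indep_xi
        indep_A beta \<delta> eta(1) L \<tau>)+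

  let ?B = "16 * (f x0 - Inf (range f)) / (?\<delta> * \<eta> * real K * real \<tau>) + 32 * \<beta>\<^sub>1 * ?v / (3 * ?\<delta>)"
  have KT: "0 < real (K * \<tau>)" using K \<tau> by simp
  have "(\<Sum>t<K * \<tau>. \<integral>\<^sup>+\<omega>. ennreal ((norm (gradf (X t \<omega>)))\<^sup>2) \<partial>M)
      \<le> ennreal (16 * (f x0 - Inf (range f)) / (?\<delta> * \<eta>) + real (K * \<tau>) * (32 * \<beta>\<^sub>1 * ?v / (3 * ?\<delta>)))"
    using f_grad A1 \<eta>L tau \<eta>_small by (intro gradient_sum_bound) auto
  also have "16 * (f x0 - Inf (range f)) / (?\<delta> * \<eta>) + real (K * \<tau>) * (32 * \<beta>\<^sub>1 * ?v / (3 * ?\<delta>)) = ?B * real (K * \<tau>)"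
  proof -
    have "a / (b * c) + p * q * w = (a / (b * c * p * q) + w) * (p * q)"
      if "p \<noteq> 0" "q \<noteq> 0" for a b c p q w :: real
      using that by (simp add: distrib_right)
    then show ?thesis unfolding of_nat_mult using K \<tau> by (metis less_nat_zero_code not_one_le_zero of_nat_eq_0_iff)
  qed
  finally have "(\<Sum>t<K * \<tau>. \<integral>\<^sup>+\<omega>. ennreal ((norm (gradf (X t \<omega>)))\<^sup>2) \<partial>M) / ennreal (real (K * \<tau>))
      \<le> ennreal (?B * real (K * \<tau>)) / ennreal (real (K * \<tau>))"
    by (rule divide_right_mono_ennreal)
  also have "\<dots> = ennreal ?B"
  proof -
    have "0 \<le> f x0 - Inf (range f)" using cInf_lower[OF _ A1, of "f x0"] by simp
    then have "0 \<le> ?B" using \<delta> eta(1) beta by (intro add_nonneg_nonneg divide_nonneg_nonneg mult_nonneg_nonneg sum_nonneg) auto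
    then have "0 \<le> ?B * real (K * \<tau>)" using KT by (intro mult_nonneg_nonneg) auto
    then have "ennreal (?B * real (K * \<tau>)) / ennreal (real (K * \<tau>)) = ennreal (?B * real (K * \<tau>) / real (K * \<tau>))"
      using KT by (rule divide_ennreal)
    also have "?B * real (K * \<tau>) / real (K * \<tau>) = ?B"
      by (rule nonzero_mult_div_cancel_right) (use KT in linarith)
    finally show ?thesis .
  qed
  finally show ?thesis unfolding X_def .
qed

end
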